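(* Let $p\in(0,1)$ be a constant and let $k\ge 3$ be an integer. For $n$ divisible by $k-1$, let $X_n(k)$ denote the number of loose Hamilton cycles in the random $k$-uniform hypergraph $H^k(n,p)$, with mean $\mu_n(k)$ and variance $\sigma_n(k)^2$. Then, as $n\to\infty$ through multiples of $k-1$, $$\frac{X_n(k)-\mu_n(k)}{\sigma_n(k)}\longrightarrow N(0,1)$$ in distribution, where $N(0,1)$ is the standard Gaussian distribution.
   Context: $H^k(n,p)$ is the random $k$-uniform hypergraph on vertex set $[n]=\{1,\dots,n\}$ in which each $k$-element subset of $[n]$ is an edge with probability $p$, independently. A loose Hamilton cycle in a $k$-uniform hypergraph on $n$ vertices is a set of $m=n/(k-1)$ edges for which there is a cyclic ordering $v_1,\dots,v_n$ of all the vertices such that each of the edges consists of $k$ consecutive vertices in this cyclic order and each two (cyclically) consecutive edges overlap in exactly one vertex; that is, the edges are $\{v_{i(k-1)+1},\dots,v_{i(k-1)+k}\}$ for $i=0,\dots,m-1$, indices modulo $n$. Loose Hamilton cycles are counted as edge sets, so (for $m\ge3$) the complete $k$-uniform hypergraph on $n$ vertices has $\frac{n!}{2m((k-2)!)^m}$ of them. *)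

theory Defs
  imports "HOL-Probability.Probability" "HOL-Combinatorics.Multiset_Permutations"
begin

text \<open>A \<open>k\<close>-uniform hypergraph on the vertex set \<open>{1..n}\<close> is represented by its edge set.\<close>

definition all_edges :: "nat \<Rightarrow> nat \<Rightarrow> nat set set" where
  "all_edges k n = {e. e \<subseteq> {1..n} \<and> card e = k}"

definition random_hypergraph :: "nat \<Rightarrow> nat \<Rightarrow> real \<Rightarrow> nat set set pmf" where
  "random_hypergraph k n p =
     map_pmf (\<lambda>b. {e \<in> all_edges k n. b e})
       (Pi_pmf (all_edges k n) False (\<lambda>_. bernoulli_pmf p))"

text \<open>
  The cyclic ordering is the list \<open>vs\<close>. Positions are numbered from \<open>0\<close>, so \<open>vs ! j\<close> is the
  vertex usually written \<open>v\<close> with index \<open>j + 1\<close>, and the positions of edge \<open>i\<close> are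
  \<open>i (k - 1), \<dots>, i (k - 1) + (k - 1)\<close>, modulo \<open>n\<close>.
\<close>

definition loose_edge :: "nat \<Rightarrow> nat \<Rightarrow> nat list \<Rightarrow> nat \<Rightarrow> nat set" where
  "loose_edge k n vs i = (\<lambda>j. vs ! ((i * (k - 1) + j) mod n)) ` {..<k}"

text \<open>
  For \<open>k \<ge> 3\<close> and at least three edges, the \<open>n div (k - 1)\<close> edges below are pairwise distinct
  \<open>k\<close>-sets and cyclically consecutive ones share exactly one vertex. With one or two edges
  the notion is degenerate; those values of \<open>n\<close> do not matter for a limit in \<open>n\<close>.
\<close>

definition loose_Hamilton_cycle :: "nat \<Rightarrow> nat \<Rightarrow> nat set set \<Rightarrow> bool" where
  "loose_Hamilton_cycle k n C \<longleftrightarrow>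
     (k - 1) dvd n \<and>
     (\<exists>vs \<in> permutations_of_set {1..n}. C = loose_edge k n vs ` {..<n div (k - 1)})"

text \<open>Cycles are counted as edge sets, not as orderings of the vertices.\<close>

definition num_loose_Hamilton :: "nat \<Rightarrow> nat \<Rightarrow> nat set set \<Rightarrow> real" where
  "num_loose_Hamilton k n H = real (card {C. C \<subseteq> H \<and> loose_Hamilton_cycle k n C})"

definition loose_Hamilton_mean :: "nat \<Rightarrow> nat \<Rightarrow> real \<Rightarrow> real" where
  "loose_Hamilton_mean k n p =
     measure_pmf.expectation (random_hypergraph k n p) (num_loose_Hamilton k n)"

definition loose_Hamilton_sd :: "nat \<Rightarrow> nat \<Rightarrow> real \<Rightarrow> real" where
  "loose_Hamilton_sd k n p =
     sqrt (measure_pmf.variance (random_hypergraph k n p) (num_loose_Hamilton k n))"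

end

theory Submission
  imports Defs
begin

text \<open>
  Let \<open>Y\<close> be the number of edges of the random hypergraph. It is binomial, so its standardization is
  asymptotically normal, and it suffices that the standardizations of \<open>X\<close> and \<open>Y\<close> become close in
  \<open>L\<^sup>2\<close>, i.e. that their correlation tends to \<open>1\<close>. Up to a constant factor, \<open>X\<close> counts the vertex
  permutations that carry one fixed cycle into the hypergraph. The covariance of \<open>X\<close> and \<open>Y\<close> is then
  explicit, and the variance of \<open>X\<close> is governed by the mean of \<open>(1/p)\<^sup>I - 1\<close>, where \<open>I\<close> is the overlap
  of the fixed cycle with a random copy of it. A given set of \<open>j\<close> edges of the cycle lies in the random
  copy with probability at most \<open>(A / n\<^bsup>k - 1\<^esup>)\<^sup>j\<close>, so for \<open>k \<ge> 3\<close> the contribution of \<open>j \<ge> 2\<close> is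
  negligible against the term \<open>j = 1\<close>, which matches the squared covariance exactly.
\<close>

section \<open>Probabilistic limit lemmas\<close>

text \<open>The delicate point is that the bound on \<open>j\<close> edges must hold for edge sets
  of every size and shape. Write \<open>d = k - 1\<close>. Heuristically, \<open>j\<close> disjoint
  edges have about \<open>m^j\<close> possible targets, each hit with probability of order
  \<open>n^(-k j)\<close>, hence order \<open>n^(-d j)\<close> in all. Edges forming a run cover
  fewer vertices, but after the first edge of a run only boundedly many targets are left, and the
  two effects cancel. The argument needs an edge outside the set at which the cycle can be cut open;
  the full cycle has none and is treated apart. Only the order matters for \<open>j >= 2\<close>, so
  constants are wasteful there: these terms total \<open>O((m / n^d)^2)\<close>, of order
  \<open>n^(2 - 2 d)\<close>, against order \<open>m^2 / n^(d + 1)\<close>, that is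
  \<open>n^(1 - d)\<close>, for \<open>j = 1\<close>. The quotient \<open>n^(1 - d)\<close> vanishes
  because \<open>d >= 2\<close>. For \<open>j = 1\<close> the constant must be exact, since the
  correlation has to tend to 1 and not merely stay away from 0.\<close>

lemma weak_conv_m_L2_close:
  fixes M :: "nat \<Rightarrow> 'a pmf" and Y Z :: "nat \<Rightarrow> 'a \<Rightarrow> real"
  assumes fin: "\<And>n. finite (set_pmf (M n))"
    and Y: "weak_conv_m (\<lambda>n. distr (measure_pmf (M n)) borel (Y n)) D"
    and D: "real_distribution D"
    and L2: "(\<lambda>n. measure_pmf.expectation (M n) (\<lambda>x. (Z n x - Y n x)\<^sup>2)) \<longlonglongrightarrow> 0"
  shows "weak_conv_m (\<lambda>n. distr (measure_pmf (M n)) borel (Z n)) D"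
proof (rule levy_continuity)
  have rd: "real_distribution (distr (measure_pmf (M n)) borel (W n))" for n and W :: "nat \<Rightarrow> 'a \<Rightarrow> real"
    by (rule prob_space.real_distribution_distr[OF measure_pmf.prob_space_axioms]) simp
  show "real_distribution (distr (measure_pmf (M n)) borel (Z n))" for n
    by (rule rd)
  show "real_distribution D" by (rule D)
  fix t :: real
  let ?cY = "\<lambda>n. char (distr (measure_pmf (M n)) borel (Y n)) t"
  let ?cZ = "\<lambda>n. char (distr (measure_pmf (M n)) borel (Z n)) t"
  let ?e = "\<lambda>n. measure_pmf.expectation (M n) (\<lambda>x. (Z n x - Y n x)\<^sup>2)"
  have int[simp]: "integrable (measure_pmf (M n)) f" for n and f :: "'a \<Rightarrow> 'b::{banach,second_countable_topology}"
    by (rule integrable_measure_pmf_finite[OF fin])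
  have cY: "?cY \<longlonglongrightarrow> char D t"
    by (rule levy_continuity1[OF rd[of _ Y] D Y])
  \<comment> \<open>The function \<open>iexp\<close> is 1-Lipschitz, so the characteristic functions
    differ by at most |t| times the L1 distance; nonnegativity of a variance then passes from L1 to
    L2.\<close>
  have bound: "cmod (?cZ n - ?cY n) \<le> \<bar>t\<bar> * sqrt (?e n)" for n
  proof -
    have lip: "cmod (iexp a - iexp b) \<le> \<bar>a - b\<bar>" for a b :: real
    proof -
      have "iexp a = iexp b * iexp (a - b)"
        by (subst exp_add[symmetric]) (simp add: algebra_simps)
      have "iexp a - iexp b = iexp b * (iexp (a - b) - 1)"
        by (subst \<open>iexp a = _\<close>) (subst right_diff_distrib, simp)
      then show ?thesis
        using iexp_approx1[of "a - b" 0] by (simp add: norm_mult)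
    qed
    have "?cZ n - ?cY n = measure_pmf.expectation (M n) (\<lambda>x. iexp (t * Z n x) - iexp (t * Y n x))"
      unfolding char_def by (simp add: integral_distr)
    also have "cmod \<dots> \<le> measure_pmf.expectation (M n) (\<lambda>x. cmod (iexp (t * Z n x) - iexp (t * Y n x)))"
      by (rule integral_norm_bound)
    also have "\<dots> \<le> measure_pmf.expectation (M n) (\<lambda>x. \<bar>t\<bar> * \<bar>Z n x - Y n x\<bar>)"
    proof (rule integral_mono)
      fix x
      show "cmod (iexp (t * Z n x) - iexp (t * Y n x)) \<le> \<bar>t\<bar> * \<bar>Z n x - Y n x\<bar>"
        using lip[of "t * Z n x" "t * Y n x"] by (simp add: abs_mult flip: right_diff_distrib)
    qed simp_all
    also have "\<dots> = \<bar>t\<bar> * measure_pmf.expectation (M n) (\<lambda>x. \<bar>Z n x - Y n x\<bar>)"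
      by simp
    also have "\<dots> \<le> \<bar>t\<bar> * sqrt (?e n)"
    proof (rule mult_left_mono)
      have "0 \<le> measure_pmf.variance (M n) (\<lambda>x. \<bar>Z n x - Y n x\<bar>)"
        by simp
      then have "(measure_pmf.expectation (M n) (\<lambda>x. \<bar>Z n x - Y n x\<bar>))\<^sup>2 \<le> ?e n"
        by (subst (asm) measure_pmf.variance_eq) simp_all
      then show "measure_pmf.expectation (M n) (\<lambda>x. \<bar>Z n x - Y n x\<bar>) \<le> sqrt (?e n)"
        by (rule real_le_rsqrt)
    qed simp
    finally show ?thesis .
  qed
  have lim0: "(\<lambda>n. \<bar>t\<bar> * sqrt (?e n)) \<longlonglongrightarrow> 0"
    using tendsto_mult[OF tendsto_const tendsto_real_sqrt[OF L2], of "\<bar>t\<bar>"] by simp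
  have "(\<lambda>n. ?cZ n - ?cY n) \<longlonglongrightarrow> 0"
    by (rule Lim_null_comparison[OF always_eventually lim0]) (intro allI bound)
  from tendsto_add[OF this cY] show "?cZ \<longlonglongrightarrow> char D t"
    by simp
qed

section \<open>Central limit theorem for binomial counts\<close>

lemma indep_vars_PiM_components:
  assumes "\<And>i. i \<in> I \<Longrightarrow> prob_space (M i)" and "I \<noteq> {}"
  shows "prob_space.indep_vars (Pi\<^sub>M I M) M (\<lambda>i f. f i) I"
proof -
  interpret P: prob_space "Pi\<^sub>M I M"
    by (rule prob_space_PiM) (use assms in auto)
  \<comment> \<open>Points of the product space are extensional, so restricting them to
    \<open>I\<close> changes nothing, and the joint law of the coordinates is the product of their
    laws.\<close>
  have "distr (Pi\<^sub>M I M) (Pi\<^sub>M I M) (\<lambda>x. restrict x I) = distr (Pi\<^sub>M I M) (Pi\<^sub>M I M) (\<lambda>x. x)"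
    by (rule distr_cong) (auto simp: space_PiM)
  also have "\<dots> = Pi\<^sub>M I (\<lambda>i. distr (Pi\<^sub>M I M) (M i) (\<lambda>f. f i))"
    by (simp add: distr_PiM_component assms cong: PiM_cong)
  finally have eq: "distr (Pi\<^sub>M I M) (Pi\<^sub>M I M) (\<lambda>x. restrict x I) =
      Pi\<^sub>M I (\<lambda>i. distr (Pi\<^sub>M I M) (M i) (\<lambda>f. f i))" .
  have "P.random_variable (M i) (\<lambda>f. f i)" if "i \<in> I" for i
    using that by (rule measurable_component_singleton)
  with eq show ?thesis
    by (subst P.indep_vars_iff_distr_eq_PiM'[OF assms(2)]) (simp_all add: restrict_def)
qed

text \<open>Only \<open>card A\<close> enters the right-hand side, so a sum over any finite edge set
  can be compared with a partial sum of one infinite coin sequence.\<close>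

lemma char_sum_coins:
  fixes p t :: real
  assumes fin: "finite A"
  shows "char (distr (measure_pmf (Pi_pmf A False (\<lambda>_. bernoulli_pmf p))) borel
             (\<lambda>b. (\<Sum>e\<in>A. f (b e)))) t
           = char (distr (measure_pmf (bernoulli_pmf p)) borel f) t ^ card A"
proof -
  let ?P = "Pi_pmf A False (\<lambda>_. bernoulli_pmf p)"
  have ind: "prob_space.indep_vars (measure_pmf ?P) (\<lambda>_. borel) (\<lambda>e b. f (b e)) A"
    by (rule prob_space.indep_vars_compose2[OF measure_pmf.prob_space_axioms indep_vars_Pi_pmf[OF fin]]) simp
  have "distr (measure_pmf ?P) borel (\<lambda>b. f (b e)) = distr (measure_pmf (bernoulli_pmf p)) borel f"
    if "e \<in> A" for e
  proof -
    have "distr (measure_pmf (map_pmf (\<lambda>b. b e) ?P)) borel f = distr (measure_pmf ?P) borel (\<lambda>b. f (b e))"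
      unfolding map_pmf_rep_eq by (subst distr_distr) (auto simp: comp_def)
    then show ?thesis using that fin by (simp add: Pi_pmf_component)
  qed
  then show ?thesis
    by (subst prob_space.char_distr_sum[OF measure_pmf.prob_space_axioms ind]) simp
qed

lemma expectation_bernoulli_pmf_real:
  fixes f :: "bool \<Rightarrow> real" and p :: real
  assumes "0 \<le> p" "p \<le> 1"
  shows "measure_pmf.expectation (bernoulli_pmf p) f = p * f True + (1 - p) * f False"
  using assms by (subst integral_measure_pmf_real[where A=UNIV]) (auto simp: UNIV_bool)

text \<open>The classical theorem concerns one infinite sequence of coins on a fixed space, whereas
  here the space changes with \<open>n\<close>. The two settings meet in the characteristic
  function, which in both is the \<open>N\<close>-th power of that of one scaled coin.\<close>

lemma binomial_central_limit:
  fixes p :: real and A :: "nat \<Rightarrow> 'a set"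
  assumes p: "0 < p" "p < 1" and fin: "\<And>n. finite (A n)"
    and lim: "filterlim (\<lambda>n. card (A n)) at_top sequentially"
  shows "weak_conv_m (\<lambda>n. distr (measure_pmf (Pi_pmf (A n) False (\<lambda>_. bernoulli_pmf p))) borel
           (\<lambda>b. (real (card {e \<in> A n. b e}) - card (A n) * p) / sqrt (card (A n) * (p * (1 - p)))))
           std_normal_distribution"
proof (rule levy_continuity)
  let ?P = "\<lambda>n. Pi_pmf (A n) False (\<lambda>_. bernoulli_pmf p)"
  let ?W = "\<lambda>n b. (real (card {e \<in> A n. b e}) - card (A n) * p) / sqrt (card (A n) * (p * (1 - p)))"
  show "real_distribution (distr (measure_pmf (?P n)) borel (?W n))" for n
    by (rule prob_space.real_distribution_distr[OF measure_pmf.prob_space_axioms]) simp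
  show "real_distribution std_normal_distribution"
    by (rule real_dist_normal_dist)
  fix t :: real
  \<comment> \<open>One centred coin, already divided by the standard deviation of a sum of
    \<open>N\<close> coins.\<close>
  define f where "f N b = (of_bool b - p) / sqrt (real N * (p * (1 - p)))" for N b
  define B where "B = measure_pmf (bernoulli_pmf p)"
  let ?M = "Pi\<^sub>M (UNIV::nat set) (\<lambda>_. B)"
  interpret B: prob_space B unfolding B_def by (rule measure_pmf.prob_space_axioms)
  interpret M: prob_space ?M by (rule prob_space_PiM) (rule B.prob_space_axioms)
  define X :: "nat \<Rightarrow> (nat \<Rightarrow> bool) \<Rightarrow> real" where "X i w = of_bool (w i)" for i w
  have [measurable]: "g \<in> measurable B borel" for g :: "bool \<Rightarrow> real" by (simp add: B_def)
  have meas[measurable]: "(\<lambda>w. g (w i)) \<in> borel_measurable ?M" for g :: "bool \<Rightarrow> real" and i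
    by measurable
  have comp: "distr ?M borel (\<lambda>w. g (w i)) = distr B borel g" for g :: "bool \<Rightarrow> real" and i
  proof -
    have "distr B borel g = distr (distr ?M B (\<lambda>w. w i)) borel g"
      by (subst distr_PiM_component) (auto simp: B.prob_space_axioms)
    also have "\<dots> = distr ?M borel (\<lambda>w. g (w i))"
      by (subst distr_distr) (auto simp: comp_def)
    finally show ?thesis by simp
  qed
  have ind: "M.indep_vars (\<lambda>_. borel) (\<lambda>i w. g (w i)) I" for g :: "bool \<Rightarrow> real" and I
  proof -
    have "M.indep_vars (\<lambda>_. B) (\<lambda>i w. w i) UNIV"
      by (rule indep_vars_PiM_components) (auto simp: B.prob_space_axioms)
    then have "M.indep_vars (\<lambda>_. B) (\<lambda>i w. w i) I" by (rule M.indep_vars_subset) auto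
    then show ?thesis by (rule M.indep_vars_compose2) simp
  qed
  have ex: "M.expectation (\<lambda>w. g (w i)) = p * g True + (1 - p) * g False" for g :: "bool \<Rightarrow> real" and i
  proof -
    have "M.expectation (\<lambda>w. g (w i)) = (\<integral>x. x \<partial>distr ?M borel (\<lambda>w. g (w i)))"
      by (subst integral_distr) auto
    also have "\<dots> = B.expectation g" unfolding comp by (subst integral_distr) auto
    finally show ?thesis unfolding B_def using p by (simp add: expectation_bernoulli_pmf_real)
  qed
  define s where "s = sqrt (p * (1 - p))"
  have s: "s > 0" "s\<^sup>2 = p * (1 - p)" using p by (auto simp: s_def)
  have "weak_conv_m (\<lambda>N. distr ?M borel (\<lambda>w. (\<Sum>i<N. X i w - p) / sqrt (real N * s\<^sup>2))) std_normal_distribution"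
  proof (rule M.central_limit_theorem)
    show "M.indep_vars (\<lambda>i. borel) X UNIV" unfolding X_def[abs_def] by (rule ind)
    show e1: "M.expectation (X i) = p" for i unfolding X_def[abs_def] by (subst ex) simp
    show "s > 0" by (rule s)
    have int: "integrable ?M (\<lambda>w. g (w i))" for g :: "bool \<Rightarrow> real" and i
    proof (rule M.integrable_const_bound)
      have "norm (g b) \<le> max \<bar>g True\<bar> \<bar>g False\<bar>" for b by (cases b) auto
      then show "AE w in ?M. norm (g (w i)) \<le> max \<bar>g True\<bar> \<bar>g False\<bar>" by (intro AE_I2)
    qed (rule meas)
    show "integrable ?M (\<lambda>w. (X i w)\<^sup>2)" for i unfolding X_def by (rule int)
    show "M.variance (X i) = s\<^sup>2" for i
      unfolding e1 unfolding X_def s(2)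
      by (subst ex) (simp only: of_bool_eq, algebra)
    show "distr ?M borel (X i) = distr B borel of_bool" for i
      unfolding X_def[abs_def] by (rule comp)
  qed
  then have "(\<lambda>N. char (distr ?M borel (\<lambda>w. (\<Sum>i<N. X i w - p) / sqrt (real N * s\<^sup>2))) t)
      \<longlonglongrightarrow> char std_normal_distribution t"
    by (intro levy_continuity1) (auto intro!: M.real_distribution_distr real_dist_normal_dist simp: X_def)
  moreover have "char (distr ?M borel (\<lambda>w. (\<Sum>i<N. X i w - p) / sqrt (real N * s\<^sup>2))) t
      = char (distr B borel (f N)) t ^ N" for N
  proof -
    have "(\<lambda>w. (\<Sum>i<N. X i w - p) / sqrt (real N * s\<^sup>2)) = (\<lambda>w. \<Sum>i<N. f N (w i))"
      by (auto simp: X_def f_def sum_divide_distrib s)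
    then show ?thesis
      using M.char_distr_sum[OF ind, of "f N" "{..<N}" t] by (simp add: comp)
  qed
  ultimately have "(\<lambda>N. char (distr B borel (f N)) t ^ N) \<longlonglongrightarrow> char std_normal_distribution t"
    by simp
  \<comment> \<open>The limit over all \<open>N\<close> is taken along
    \<open>N = card (A n)\<close>.\<close>
  from filterlim_compose[OF this lim]
  have "(\<lambda>n. char (distr B borel (f (card (A n)))) t ^ card (A n)) \<longlonglongrightarrow> char std_normal_distribution t" .
  moreover have "?W n = (\<lambda>b. \<Sum>e\<in>A n. f (card (A n)) (b e))" for n
  proof
    fix b
    have "(\<Sum>e\<in>A n. of_bool (b e) :: real) = card {e \<in> A n. b e}"
      using fin by (subst sum_of_bool_eq) (auto simp: Int_def)
    then show "?W n b = (\<Sum>e\<in>A n. f (card (A n)) (b e))"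
      by (simp add: f_def sum_subtractf flip: sum_divide_distrib)
  qed
  ultimately show "(\<lambda>n. char (distr (measure_pmf (?P n)) borel (?W n)) t) \<longlonglongrightarrow> char std_normal_distribution t"
    by (simp add: char_sum_coins[OF fin] B_def)
qed

section \<open>Distance of standardized counts through their correlation\<close>

text \<open>Two standardized variables with correlation \<rho> have squared L2 distance
  \<open>2 - 2 * \<rho>\<close>. The covariance is computed exactly, and \<open>bound\<close> limits
  the variance of \<open>X\<close> from above, hence \<rho> from below. The index set
  \<open>G\<close> allows the same set \<open>C s\<close> to occur several times.\<close>

lemma standardized_distance_le:
  fixes M :: "'a set pmf" and p \<delta> :: real and C :: "'b \<Rightarrow> 'a set"
  assumes fin: "finite (set_pmf M)" and E: "finite E" "E \<noteq> {}"
    and ex: "\<And>A. A \<subseteq> E \<Longrightarrow> measure_pmf.expectation M (\<lambda>H. of_bool (A \<subseteq> H)) = p ^ card A"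
    and p: "0 < p" "p < 1"
    and G: "finite G" "G \<noteq> {}" and C: "\<And>s. s \<in> G \<Longrightarrow> C s \<subseteq> E" "\<And>s. s \<in> G \<Longrightarrow> card (C s) = m"
    and m: "1 \<le> m"
    and bound: "(\<Sum>s\<in>G. \<Sum>t\<in>G. (1 / p) ^ card (C s \<inter> C t) - 1)
                  \<le> (real (card G))\<^sup>2 * ((1 / p - 1) * (real m)\<^sup>2 / card E + \<delta>)"
  defines "X \<equiv> \<lambda>H. \<Sum>s\<in>G. of_bool (C s \<subseteq> H) :: real"
    and "Y \<equiv> \<lambda>H. \<Sum>e\<in>E. of_bool ({e} \<subseteq> H) :: real"
  shows "measure_pmf.expectation M (\<lambda>H.
           ((X H - measure_pmf.expectation M X) / sqrt (measure_pmf.variance M X)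
             - (Y H - card E * p) / sqrt (card E * (p * (1 - p))))\<^sup>2)
           \<le> 2 * card E * \<delta> / ((1 / p - 1) * (real m)\<^sup>2)"
proof -
  let ?E = "measure_pmf.expectation M :: ('a set \<Rightarrow> real) \<Rightarrow> real"
  have int[simp]: "integrable (measure_pmf M) f" for f :: "'a set \<Rightarrow> real"
    by (rule integrable_measure_pmf_finite[OF fin])
  define g N r where "g = real (card G)" and "N = real (card E)" and "r = 1 / p - 1"
  have pos: "0 < g" "0 < N" "0 < r" "0 < real m"
    using E G p m by (auto simp: g_def N_def r_def card_gt_0_iff)
  have finC: "finite (C s)" if "s \<in> G" for s using C(1)[OF that] E finite_subset by blast
  define a b where "a = ?E X" and "b = ?E Y"
  have a: "a = g * p ^ m"
    unfolding a_def X_def using C by (simp add: ex g_def)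
  have b: "b = N * p"
    unfolding b_def Y_def using ex[of "{_}"] by (simp add: N_def)
  have cov: "?E (\<lambda>H. (U H - ?E U) * (V H - ?E V)) = ?E (\<lambda>H. U H * V H) - ?E U * ?E V" for U V :: "'a set \<Rightarrow> real"
  proof -
    define u v where "u = ?E U" and "v = ?E V"
    have "?E (\<lambda>H. (U H - u) * (V H - v)) = ?E (\<lambda>H. U H * V H - v * U H - u * V H + u * v)"
      by (intro arg_cong[where f = ?E] ext) (simp add: algebra_simps)
    also have "\<dots> = ?E (\<lambda>H. U H * V H) - v * ?E U - u * ?E V + u * v"
      by simp
    finally show ?thesis by (simp add: u_def v_def)
  qed
  have prod: "?E (\<lambda>H. (\<Sum>i\<in>I. of_bool (A i \<subseteq> H)) * (\<Sum>j\<in>J. of_bool (B j \<subseteq> H))) =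
      (\<Sum>i\<in>I. \<Sum>j\<in>J. p ^ card (A i \<union> B j))"
    if "\<And>i. i \<in> I \<Longrightarrow> A i \<subseteq> E" "\<And>j. j \<in> J \<Longrightarrow> B j \<subseteq> E"
    for I J and A :: "'c \<Rightarrow> 'a set" and B :: "'d \<Rightarrow> 'a set"
  proof -
    have "(\<lambda>H. (\<Sum>i\<in>I. of_bool (A i \<subseteq> H)) * (\<Sum>j\<in>J. of_bool (B j \<subseteq> H))) =
        (\<lambda>H. \<Sum>i\<in>I. \<Sum>j\<in>J. of_bool (A i \<union> B j \<subseteq> H) :: real)"
      by (simp add: sum_product fun_eq_iff flip: of_bool_conj)
    then have "?E (\<lambda>H. (\<Sum>i\<in>I. of_bool (A i \<subseteq> H)) * (\<Sum>j\<in>J. of_bool (B j \<subseteq> H))) =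
        ?E (\<lambda>H. \<Sum>i\<in>I. \<Sum>j\<in>J. of_bool (A i \<union> B j \<subseteq> H))" by (rule arg_cong)
    also have "\<dots> = (\<Sum>i\<in>I. \<Sum>j\<in>J. ?E (\<lambda>H. of_bool (A i \<union> B j \<subseteq> H)))"
      by (simp only: Bochner_Integration.integral_sum int)
    also have "\<dots> = (\<Sum>i\<in>I. \<Sum>j\<in>J. p ^ card (A i \<union> B j))"
      using that by (intro sum.cong refl ex) blast
    finally show ?thesis .
  qed
  define S where "S = (\<Sum>s\<in>G. \<Sum>t\<in>G. (1 / p) ^ card (C s \<inter> C t) - 1)"
  have VX: "?E (\<lambda>H. (X H - a)\<^sup>2) = p ^ (2 * m) * S"
  proof -
    have "?E (\<lambda>H. (X H - a)\<^sup>2) = ?E (\<lambda>H. X H * X H) - a * a"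
      using cov[of X X] by (simp add: a_def power2_eq_square)
    also have "?E (\<lambda>H. X H * X H) = (\<Sum>s\<in>G. \<Sum>t\<in>G. p ^ card (C s \<union> C t))"
      unfolding X_def by (rule prod) (simp_all add: C)
    also have "\<dots> = (\<Sum>s\<in>G. \<Sum>t\<in>G. p ^ (2 * m) * (1 / p) ^ card (C s \<inter> C t))"
    proof (intro sum.cong refl)
      fix s t assume st: "s \<in> G" "t \<in> G"
      \<comment> \<open>Inclusion-exclusion trades the union for the intersection; subtracting the
        squared mean later produces the \<open>- 1\<close> in \<open>S\<close>.\<close>
      have "card (C s \<union> C t) + card (C s \<inter> C t) = 2 * m"
        using card_Un_Int[OF finC[OF st(1)] finC[OF st(2)]] C st by simp
      then have "p ^ (2 * m) = p ^ card (C s \<union> C t) * p ^ card (C s \<inter> C t)"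
        by (metis power_add)
      then show "p ^ card (C s \<union> C t) = p ^ (2 * m) * (1 / p) ^ card (C s \<inter> C t)"
        using p by (simp add: power_divide)
    qed
    also have "\<dots> - a * a = p ^ (2 * m) * S"
    proof -
      have "a * a = p ^ (2 * m) * (g * g)" unfolding a by (simp add: power_mult power2_eq_square mult_2 power_add)
      then show ?thesis
        by (simp add: S_def sum_subtractf sum_distrib_left right_diff_distrib g_def)
    qed
    finally show ?thesis .
  qed
  have VY: "?E (\<lambda>H. (Y H - b)\<^sup>2) = N * (p * (1 - p))"
  proof -
    have "?E (\<lambda>H. (Y H - b)\<^sup>2) = ?E (\<lambda>H. Y H * Y H) - b * b"
      using cov[of Y Y] by (simp add: b_def power2_eq_square)
    also have "?E (\<lambda>H. Y H * Y H) = (\<Sum>e\<in>E. \<Sum>f\<in>E. p ^ card ({e} \<union> {f}))"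
      unfolding Y_def by (rule prod) simp_all
    also have "\<dots> = (\<Sum>e\<in>E. N * p\<^sup>2 + p * (1 - p))"
    proof (rule sum.cong[OF refl])
      fix e assume e: "e \<in> E"
      \<comment> \<open>Only the diagonal term \<open>f = e\<close> deviates from
        \<open>p\<^sup>2\<close>, by \<open>p - p\<^sup>2\<close>.\<close>
      have "(\<Sum>f\<in>E. p ^ card ({e} \<union> {f})) = (\<Sum>f\<in>E. p\<^sup>2 + (if f = e then p * (1 - p) else 0))"
        by (intro sum.cong refl) (auto simp: card_insert_if power2_eq_square algebra_simps)
      then show "(\<Sum>f\<in>E. p ^ card ({e} \<union> {f})) = N * p\<^sup>2 + p * (1 - p)"
        using e E by (simp add: sum.distrib N_def)
    qed
    also have "\<dots> = N * (N * p\<^sup>2 + p * (1 - p))" by (simp add: N_def)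
    finally show ?thesis by (simp add: b power2_eq_square algebra_simps)
  qed
  have CXY: "?E (\<lambda>H. (X H - a) * (Y H - b)) = g * m * p ^ m * (1 - p)"
  proof -
    have "?E (\<lambda>H. (X H - a) * (Y H - b)) = ?E (\<lambda>H. X H * Y H) - a * b"
      using cov[of X Y] by (simp add: a_def b_def)
    also have "?E (\<lambda>H. X H * Y H) = (\<Sum>s\<in>G. \<Sum>e\<in>E. p ^ card (C s \<union> {e}))"
      unfolding X_def Y_def by (rule prod) (simp_all add: C)
    also have "\<dots> = (\<Sum>s\<in>G. N * p ^ Suc m + m * (p ^ m * (1 - p)))"
    proof (rule sum.cong[OF refl])
      fix s assume s: "s \<in> G"
      \<comment> \<open>An edge already in \<open>C s\<close> leaves the size at \<open>m\<close>,
        whence the surplus \<open>p ^ m - p ^ Suc m\<close>.\<close>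
      have "(\<Sum>e\<in>E. p ^ card (C s \<union> {e})) = (\<Sum>e\<in>E. p ^ Suc m + (if e \<in> C s then p ^ m * (1 - p) else 0))"
        using C(2)[OF s] finC[OF s] by (intro sum.cong refl) (auto simp: insert_absorb algebra_simps)
      also have "\<dots> = N * p ^ Suc m + (\<Sum>e\<in>E \<inter> C s. p ^ m * (1 - p))"
        using E by (simp add: sum.distrib sum.inter_restrict[symmetric] N_def)
      also have "E \<inter> C s = C s" using C(1)[OF s] by blast
      finally show "(\<Sum>e\<in>E. p ^ card (C s \<union> {e})) = N * p ^ Suc m + m * (p ^ m * (1 - p))"
        using C(2)[OF s] by simp
    qed
    also have "\<dots> = g * (N * p ^ Suc m + m * (p ^ m * (1 - p)))" by (simp add: g_def)
    finally show ?thesis by (simp add: a b algebra_simps)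
  qed
  \<comment> \<open>All summands are nonnegative and the diagonal ones are positive.\<close>
  have S_pos: "0 < S"
    unfolding S_def
  proof (rule sum_pos[OF G])
    fix s assume s: "s \<in> G"
    have "1 < (1 / p) ^ m" using p m by (intro one_less_power) auto
    then show "0 < (\<Sum>t\<in>G. (1 / p) ^ card (C s \<inter> C t) - 1)"
      using s C(2)[OF s] G p by (intro sum_pos2[of G s]) auto
  qed
  \<comment> \<open>Here \<open>u\<close> and \<open>v\<close> are the standard deviations of
    \<open>X\<close> and \<open>Y\<close>, and \<open>c\<close> is their covariance.\<close>
  define u v c where "u = sqrt (p ^ (2 * m) * S)" and "v = sqrt (N * (p * (1 - p)))" and "c = g * m * p ^ m * (1 - p)"
  have u: "0 < u" "u\<^sup>2 = p ^ (2 * m) * S" and v: "0 < v" "v\<^sup>2 = N * (p * (1 - p))"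
    using S_pos p pos by (auto simp: u_def v_def)
  have c: "0 < c" using pos p by (simp add: c_def)
  define \<rho> where "\<rho> = c / (u * v)"
  let ?D = "?E (\<lambda>H. ((X H - a) / u - (Y H - b) / v)\<^sup>2)"
  have D: "?D = 2 - 2 * \<rho>"
  proof -
    have "?D = ?E (\<lambda>H. (X H - a)\<^sup>2 / u\<^sup>2 + (Y H - b)\<^sup>2 / v\<^sup>2 - 2 * ((X H - a) * (Y H - b)) / (u * v))"
      by (intro arg_cong[where f = ?E] ext) (simp add: power2_diff power_divide)
    also have "\<dots> = ?E (\<lambda>H. (X H - a)\<^sup>2) / u\<^sup>2 + ?E (\<lambda>H. (Y H - b)\<^sup>2) / v\<^sup>2
        - 2 * ?E (\<lambda>H. (X H - a) * (Y H - b)) / (u * v)"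
      by simp
    also have "\<dots> = 2 - 2 * \<rho>"
      unfolding VX VY CXY u(2)[symmetric] v(2)[symmetric] using u(1) v(1) by (simp add: \<rho>_def c_def)
    finally show ?thesis .
  qed
  \<comment> \<open>Cauchy-Schwarz for free: a mean square is nonnegative.\<close>
  have "0 \<le> ?D" by simp
  then have "\<rho> \<le> 1" using D by linarith
  moreover have "0 < \<rho>" using c u(1) v(1) by (simp add: \<rho>_def)
  ultimately have \<rho>: "0 < \<rho>" "\<rho> \<le> 1" by blast+
  \<comment> \<open>\<open>B\<close> is the value of \<open>S / g\<^sup>2\<close> that would mean
    perfect correlation, and \<epsilon> is the relative excess allowed by \<delta>.\<close>
  define \<epsilon> where "\<epsilon> = \<delta> * N / (r * (real m)\<^sup>2)"
  define B where "B = r * (real m)\<^sup>2 / N"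
  have B: "0 < B" using pos by (simp add: B_def)
  have \<epsilon>: "B + \<delta> = B * (1 + \<epsilon>)" using pos by (simp add: B_def \<epsilon>_def field_simps)
  have "S \<le> g\<^sup>2 * (B + \<delta>)" using bound by (simp add: S_def g_def B_def N_def r_def)
  then have "S \<le> g\<^sup>2 * B * (1 + \<epsilon>)" by (simp add: \<epsilon> mult.assoc)
  have "\<rho>\<^sup>2 = g\<^sup>2 * B / S"
  proof -
    have "\<rho>\<^sup>2 = c\<^sup>2 / (u\<^sup>2 * v\<^sup>2)" by (simp add: \<rho>_def power_divide power_mult_distrib)
    also have "c\<^sup>2 = g\<^sup>2 * (real m)\<^sup>2 * p ^ (2 * m) * (1 - p)\<^sup>2"
      by (simp add: c_def power_mult_distrib power_mult[symmetric] mult.commute)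
    also have "\<dots> / (u\<^sup>2 * v\<^sup>2) = g\<^sup>2 * B / S"
      unfolding u(2) v(2) B_def r_def using p pos S_pos by (simp add: field_simps power2_eq_square)
    finally show ?thesis .
  qed
  then have \<rho>2: "\<rho>\<^sup>2 * S = g\<^sup>2 * B" using S_pos by simp
  have "\<rho>\<^sup>2 * S * (1 + \<epsilon>) \<ge> S" unfolding \<rho>2 using \<open>S \<le> g\<^sup>2 * B * (1 + \<epsilon>)\<close> .
  then have 1: "1 \<le> \<rho>\<^sup>2 * (1 + \<epsilon>)" using S_pos by (simp add: mult.assoc mult.left_commute)
  \<comment> \<open>The chain is \<open>1 - \<rho> <= 1 - \<rho>\<^sup>2 <= \<rho>\<^sup>2 *
    \<epsilon> <= \<epsilon>\<close>. Its last link needs the sign of \<epsilon>, which is forced by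
    \<open>\<rho>\<^sup>2 <= 1\<close>.\<close>
  have "\<rho>\<^sup>2 \<le> \<rho>" "\<rho>\<^sup>2 \<le> 1" using \<rho> by (auto simp: power2_eq_square mult_le_one mult_left_le)
  have "0 \<le> \<epsilon>"
  proof (rule ccontr)
    assume "\<not> 0 \<le> \<epsilon>"
    then have "\<rho>\<^sup>2 * (1 + \<epsilon>) < \<rho>\<^sup>2 * 1" using \<rho> by (intro mult_strict_left_mono) auto
    then show False using 1 \<open>\<rho>\<^sup>2 \<le> 1\<close> by simp
  qed
  then have "\<rho>\<^sup>2 * \<epsilon> \<le> 1 * \<epsilon>" using \<open>\<rho>\<^sup>2 \<le> 1\<close> by (intro mult_right_mono)
  then have "1 - \<rho> \<le> \<epsilon>" using 1 \<open>\<rho>\<^sup>2 \<le> \<rho>\<close> by (simp add: distrib_left)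
  then have "?D \<le> 2 * \<epsilon>" unfolding D by simp
  moreover have "measure_pmf.variance M X = p ^ (2 * m) * S" using VX by (simp add: a_def)
  ultimately show ?thesis
    by (simp add: u_def v_def a_def[symmetric] b N_def \<epsilon>_def r_def mult.commute mult.left_commute)
qed

section \<open>Permutations with prescribed images of edges\<close>

text \<open>A falling factorial of length \<open>u\<close> is at least \<open>(n / e)^u\<close>,
  even for \<open>u\<close> near \<open>n\<close>, where it is far below \<open>n^u\<close>. The
  induction step rests on \<open>(1 + 1 / n)^v <= e\<close> for \<open>v <= n\<close>. The powers of
  \<open>e\<close> in later constants come from here.\<close>

lemma power_divide_exp_le_fact:
  fixes n u :: nat
  assumes "u \<le> n"
  shows "(n / exp 1) ^ u * fact (n - u) \<le> (fact n :: real)"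
  using assms
proof (induction n arbitrary: u)
  case (Suc n)
  show ?case
  proof (cases u)
    case (Suc v)
    then have v: "v \<le> n" using Suc.prems by simp
    show ?thesis
    proof (cases "n = 0")
      case False
      have "(1 + 1 / n) ^ v \<le> exp (1 / n) ^ v"
        by (rule power_mono) (auto simp: exp_ge_add_one_self add_nonneg_nonneg)
      also have "\<dots> = exp (v / n)" by (simp flip: exp_of_nat_mult)
      also have "\<dots> \<le> exp 1" using v False by simp
      finally have 1: "(1 + 1 / n) ^ v \<le> exp 1" .
      have "(Suc n / exp 1) ^ v = (1 + 1 / n) ^ v * (n / exp 1) ^ v"
        using False by (simp add: field_simps flip: power_mult_distrib)
      also have "\<dots> \<le> exp 1 * (n / exp 1) ^ v"
        by (rule mult_right_mono[OF 1]) simp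
      finally have "(Suc n / exp 1) ^ v / exp 1 \<le> (n / exp 1) ^ v"
        by (simp add: field_simps)
      then have "Suc n * ((Suc n / exp 1) ^ v / exp 1) * fact (n - v) \<le> Suc n * (n / exp 1) ^ v * fact (n - v)"
        by (intro mult_right_mono mult_left_mono) auto
      also have "\<dots> \<le> real (Suc n) * fact n"
        using Suc.IH[OF v] by (simp only: mult.assoc) (rule mult_left_mono, simp_all)
      finally show ?thesis using Suc by (simp add: mult_ac)
    qed (use Suc v in auto)
  qed auto
qed auto

text \<open>Both sides are compared with \<open>exp x\<close>. This bounds what an expansion over
  subsets leaves after the empty set and the singletons are removed.\<close>

lemma power_one_plus_le_quadratic:
  fixes x :: real
  assumes "0 \<le> x" "x \<le> 1"
  shows "(1 + x / m) ^ m - 1 - x \<le> x\<^sup>2"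
proof (cases "m = 0")
  case False
  have "(1 + x / m) ^ m \<le> exp (x / m) ^ m"
    using assms by (intro power_mono) (auto simp: exp_ge_add_one_self)
  also have "\<dots> = exp x" using False by (simp flip: exp_of_nat_mult)
  also have "\<dots> \<le> 1 + x + x\<^sup>2" by (rule exp_bound) (use assms in auto)
  finally show ?thesis by simp
qed (use assms in \<open>simp add: order_trans[of _ 0]\<close>)

lemma sum_Pow_power_card:
  fixes q :: "'b::comm_semiring_1"
  assumes "finite A"
  shows "(\<Sum>S\<in>Pow A. q ^ card S) = (1 + q) ^ card A"
  using prod_add[of A "\<lambda>_. q" "\<lambda>_. 1"] assms by (simp add: add.commute)

section \<open>Setwise stabilizers and their cosets\<close>

lemma card_permutes_comp_cong:
  assumes "t permutes V"
  shows "card {s. s permutes V \<and> P (t \<circ> s)} = card {s. s permutes V \<and> P s}"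
proof (rule bij_betw_same_card[of "\<lambda>s. t \<circ> s"], rule bij_betwI[of _ _ _ "\<lambda>s. inv t \<circ> s"])
  note a = permutes_inv_o[OF assms] permutes_inv[OF assms]
  show "(\<lambda>s. inv t \<circ> s) \<in> {s. s permutes V \<and> P s} \<rightarrow> {s. s permutes V \<and> P (t \<circ> s)}"
    using a by (auto intro: permutes_compose simp flip: comp_assoc)
qed (use assms in \<open>auto intro: permutes_compose simp: permutes_inv_o simp flip: comp_assoc\<close>)

text \<open>Such a permutation is determined by its restrictions to the blocks \<open>P i\<close>
  and to the complement of their union. Blocks may overlap, so the restrictions are not independent
  and only an upper bound results.\<close>

lemma card_setwise_stabilizer_le:
  assumes "finite V" and "finite T" and sub: "\<And>i. i \<in> T \<Longrightarrow> P i \<subseteq> V"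
  shows "card {s. s permutes V \<and> (\<forall>i\<in>T. s ` P i = P i)}
           \<le> (\<Prod>i\<in>T. fact (card (P i))) * fact (card (V - \<Union>(P ` T)))"
proof -
  let ?r = "\<lambda>e s x. if x \<in> e then s x else x"
  let ?G = "{s. s permutes V \<and> (\<forall>i\<in>T. s ` P i = P i)}"
  let ?R = "V - \<Union>(P ` T)"
  let ?T = "(\<Pi>\<^sub>E i\<in>T. {s. s permutes P i}) \<times> {s. s permutes ?R}"
  define F where "F s = (\<lambda>i\<in>T. ?r (P i) s, ?r ?R s)" for s :: "'a \<Rightarrow> 'a"
  have fin: "finite (P i)" if "i \<in> T" for i using sub[OF that] assms(1) finite_subset by auto
  have restr: "?r e s permutes e" if "s permutes V" "s ` e = e" for e s
    by (rule bij_imp_permutes) (use that permutes_inj_on[OF that(1), of e] in \<open>auto simp: bij_betw_def inj_on_def image_iff\<close>)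
  have "inj_on F ?G"
  proof (rule inj_onI)
    fix s t assume s: "s \<in> ?G" and t: "t \<in> ?G" and eq: "F s = F t"
    show "s = t"
    proof
      fix x
      consider i where "i \<in> T" "x \<in> P i" | "x \<in> ?R" | "x \<notin> V" by blast
      then show "s x = t x"
      proof cases
        case 1
        then have "?r (P i) s = ?r (P i) t" using eq by (auto simp: F_def dest: fun_cong[of _ _ i])
        from fun_cong[OF this, of x] 1 show ?thesis by simp
      next
        case 2
        have "?r ?R s = ?r ?R t" using eq by (simp add: F_def)
        from fun_cong[OF this, of x] 2 show ?thesis by simp
      next
        case 3
        then show ?thesis using s t by (auto simp: permutes_not_in)
      qed
    qed
  qed
  moreover have "F ` ?G \<subseteq> ?T"
  proof
    fix y assume "y \<in> F ` ?G"
    then obtain s where s: "s permutes V" "\<And>i. i \<in> T \<Longrightarrow> s ` P i = P i" and y: "y = F s" by auto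
    have "s ` \<Union>(P ` T) = \<Union>(P ` T)" using s(2) by (auto simp: image_Union)
    moreover have "s ` V = V" using s(1) by (rule permutes_image)
    ultimately have "s ` ?R = ?R"
      using permutes_inj[OF s(1)] by (metis image_set_diff)
    then have "?r ?R s permutes ?R" by (rule restr[OF s(1)])
    then show "y \<in> ?T" using s restr[OF s(1)] by (simp add: y F_def del: Diff_iff)
  qed
  moreover have "finite ?T"
    using assms fin by (intro finite_cartesian_product finite_PiE) (auto simp: finite_permutations)
  ultimately have "card ?G \<le> card ?T" by (rule card_inj_on_le)
  also have "\<dots> = (\<Prod>i\<in>T. fact (card (P i))) * fact (card ?R)"
    using assms fin by (simp add: card_cartesian_product card_PiE card_permutations)
  finally show ?thesis .
qed

text \<open>As soon as one permutation \<open>t\<close> has the prescribed images, all of them form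
  the coset of the setwise stabilizer through \<open>t\<close>.\<close>

lemma card_permutes_prescribed_le:
  assumes "finite V" and "finite T" and sub: "\<And>i. i \<in> T \<Longrightarrow> P i \<subseteq> V"
  shows "card {s. s permutes V \<and> (\<forall>i\<in>T. s ` P i = f i)}
           \<le> (\<Prod>i\<in>T. fact (card (P i))) * fact (card (V - \<Union>(P ` T)))"
proof (cases "\<exists>t. t permutes V \<and> (\<forall>i\<in>T. t ` P i = f i)")
  case True
  then obtain t where t: "t permutes V" "\<And>i. i \<in> T \<Longrightarrow> t ` P i = f i" by auto
  have "card {s. s permutes V \<and> (\<forall>i\<in>T. s ` P i = f i)} =
        card {s. s permutes V \<and> (\<forall>i\<in>T. (t \<circ> s) ` P i = f i)}"
    using card_permutes_comp_cong[OF t(1), of "\<lambda>s. \<forall>i\<in>T. s ` P i = f i"] by simp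
  also have "{s. s permutes V \<and> (\<forall>i\<in>T. (t \<circ> s) ` P i = f i)} =
      {s. s permutes V \<and> (\<forall>i\<in>T. s ` P i = P i)}"
  proof -
    have "(t \<circ> s) ` P i = f i \<longleftrightarrow> s ` P i = P i" if "i \<in> T" for s i
      using t(2)[OF that] inj_image_eq_iff[OF permutes_inj[OF t(1)], of "s ` P i" "P i"]
      by (simp add: image_comp)
    then show ?thesis by auto
  qed
  finally show ?thesis using card_setwise_stabilizer_le[OF assms] by simp
next
  case False
  then have "{s. s permutes V \<and> (\<forall>i\<in>T. s ` P i = f i)} = {}" by blast
  then show ?thesis by (simp only: card.empty)
qed

section \<open>Overlaps of loose Hamilton cycles\<close>

text \<open>With \<open>d = k - 1\<close>, the set \<open>std_edge d m i\<close> is the \<open>i\<close>-th loose edge for the vertex ordering \<open>1, \<dots>, m d\<close>.\<close>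

definition std_edge :: "nat \<Rightarrow> nat \<Rightarrow> nat \<Rightarrow> nat set" where
  "std_edge d m i = (\<lambda>x. Suc (x mod (m * d))) ` {i * d..i * d + d}"

definition std_cycle :: "nat \<Rightarrow> nat \<Rightarrow> nat set set" where
  "std_cycle d m = std_edge d m ` {..<m}"

text \<open>In a window of \<open>N\<close> consecutive positions, reduction modulo \<open>N\<close>
  loses nothing, so cyclic edges can be handled there as integer intervals.\<close>

lemma inj_on_mod_window: "inj_on (\<lambda>x. Suc (x mod N)) {c..<c + N}" for c N :: nat
proof (rule linorder_inj_onI')
  fix x y :: nat assume x: "x \<in> {c..<c + N}" and y: "y \<in> {c..<c + N}" and "x < y"
  then have "\<not> N dvd y - x" by (auto dest: dvd_imp_le)
  then show "Suc (x mod N) \<noteq> Suc (y mod N)"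
    using \<open>x < y\<close> mod_eq_dvd_iff_nat[of x y N] by (metis less_imp_le nat.inject)
qed

lemma finite_std_edge [simp]: "finite (std_edge d m i)"
  by (simp add: std_edge_def)

lemma finite_std_cycle [simp]: "finite (std_cycle d m)"
  by (simp add: std_cycle_def)

lemma std_edge_subset: "0 < d \<Longrightarrow> 0 < m \<Longrightarrow> std_edge d m i \<subseteq> {1..m * d}"
  by (auto simp: std_edge_def Suc_le_eq)

lemma card_std_edge:
  assumes "0 < d" "2 \<le> m"
  shows "card (std_edge d m i) = Suc d"
proof -
  have "d < m * d" using assms by simp
  then have "x < i * d + m * d" if "x \<le> i * d + d" for x using that by linarith
  then have "inj_on (\<lambda>x. Suc (x mod (m * d))) {i * d..i * d + d}"
    by (intro inj_on_subset[OF inj_on_mod_window[of _ "i * d"]]) auto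
  then show ?thesis by (simp add: std_edge_def card_image)
qed

lemma std_edge_add_period: "std_edge d m (i + m) = std_edge d m i"
proof -
  have "{(i + m) * d..(i + m) * d + d} = (\<lambda>x. x + m * d) ` {i * d..i * d + d}"
    by (simp add: algebra_simps)
  then show ?thesis
    unfolding std_edge_def by (simp only: image_image mod_add_self2)
qed

lemma inj_on_std_edge:
  assumes "2 \<le> d"
  shows "inj_on (std_edge d m) {..<m}"
proof (rule linorder_inj_onI')
  fix i j assume ij: "i \<in> {..<m}" "j \<in> {..<m}" "i < j"
  have le: "i * d + d \<le> j * d" using mult_le_mono1[of "Suc i" j d] ij by simp
  have le2: "j * d + d \<le> m * d" using mult_le_mono1[of "Suc j" m d] ij by simp
  \<comment> \<open>Position \<open>i * d + 1\<close> is interior to edge \<open>i\<close> because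
    \<open>d >= 2\<close>. A later edge \<open>j\<close> only has positions from
    \<open>j * d\<close> on and, after wrapping, position \<open>0\<close>.\<close>
  have "i * d + 1 < m * d" using le le2 assms by simp
  then have "Suc (i * d + 1) \<in> std_edge d m i"
    using assms unfolding std_edge_def by (intro image_eqI[of _ _ "i * d + 1"]) auto
  moreover have "Suc (i * d + 1) \<notin> std_edge d m j"
  proof
    assume "Suc (i * d + 1) \<in> std_edge d m j"
    then obtain x where x: "j * d \<le> x" "x \<le> j * d + d" "x mod (m * d) = i * d + 1"
      by (auto simp: std_edge_def)
    show False
    proof (cases "x < m * d")
      case True
      then show False using x le assms by simp
    next
      case False
      then have "x = m * d" using x le2 by simp
      then show False using x by simp
    qed
  qed
  ultimately show "std_edge d m i \<noteq> std_edge d m j" by metis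
qed

lemma card_std_cycle: "2 \<le> d \<Longrightarrow> card (std_cycle d m) = m"
  by (simp add: std_cycle_def card_image inj_on_std_edge)

text \<open>With edge \<open>a\<close> left out, the edges \<open>a + 1, ..., a + m - 1\<close> fit
  into the window of length \<open>m * d\<close> that starts at \<open>a * d + d\<close>. They
  therefore meet like intervals on a line, with no contact around the cycle.\<close>

lemma std_edge_Int:
  assumes "0 < d" "1 \<le> s" "s < b" "b < m"
  shows "std_edge d m (a + s) \<inter> std_edge d m (a + b) =
    (if b = Suc s then {Suc ((a + b) * d mod (m * d))} else {})"
proof -
  let ?f = "\<lambda>x. Suc (x mod (m * d))"
  have 1: "a * d + d \<le> (a + s) * d" "(a + s) * d + d \<le> (a + b) * d" "(a + b) * d + d \<le> a * d + m * d"
    using mult_le_mono1[of "Suc a" "a + s" d] mult_le_mono1[of "Suc (a + s)" "a + b" d]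
      mult_le_mono1[of "Suc (a + b)" "a + m" d] assms by (simp_all add: algebra_simps)
  have "std_edge d m (a + s) \<inter> std_edge d m (a + b) =
      ?f ` ({(a + s) * d..(a + s) * d + d} \<inter> {(a + b) * d..(a + b) * d + d})"
    unfolding std_edge_def
    by (rule inj_on_image_Int[OF inj_on_mod_window[of _ "a * d + d"], symmetric])
       (use 1 assms in auto)
  also have "{(a + s) * d..(a + s) * d + d} \<inter> {(a + b) * d..(a + b) * d + d} =
      (if b = Suc s then {(a + b) * d} else {})"
  proof (cases "b = Suc s")
    case False
    then have "(a + s) * d + d < (a + b) * d"
      using mult_less_mono1[of "Suc (a + s)" "a + b" d] assms by simp
    with False show ?thesis by auto
  qed (use 1 in \<open>auto simp: algebra_simps\<close>)
  finally show ?thesis by simp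
qed

text \<open>For each offset \<open>j <= d\<close> of \<open>v\<close> within an edge, at most one
  edge is possible. Any bound depending on \<open>d\<close> alone serves the purpose.\<close>

lemma card_std_cycle_at_le:
  assumes "0 < d"
  shows "card {e \<in> std_cycle d m. v \<in> e} \<le> Suc d"
proof -
  let ?I = "\<lambda>j. {i. i < m \<and> Suc ((i * d + j) mod (m * d)) = v}"
  have one: "card (?I j) \<le> 1" for j
  proof -
    have eq: "x = y" if "x \<in> ?I j" "y \<in> ?I j" for x y
    proof -
      have win: "i * d + j \<in> {j..<j + m * d}" if "i < m" for i
        using that assms by simp
      have "x * d + j = y * d + j"
        by (rule inj_onD[OF inj_on_mod_window _ win win]) (use that in simp_all)
      then show "x = y" using assms by simp
    qed
    have fin: "finite (?I j)" by simp
    show ?thesis unfolding One_nat_def card_le_Suc0_iff_eq[OF fin] by (intro ballI eq)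
  qed
  have "{e \<in> std_cycle d m. v \<in> e} \<subseteq> std_edge d m ` (\<Union>j\<in>{..d}. ?I j)"
  proof
    fix e assume "e \<in> {e \<in> std_cycle d m. v \<in> e}"
    then obtain i x where i: "i < m" "e = std_edge d m i" and x: "x \<in> {i * d..i * d + d}" "v = Suc (x mod (m * d))"
      by (auto simp: std_cycle_def std_edge_def)
    define j where "j = x - i * d"
    have j: "x = i * d + j" "j \<in> {..d}" using x(1) by (auto simp: j_def)
    have "i \<in> ?I j" using i(1) x(2) by (simp add: j(1))
    with j(2) show "e \<in> std_edge d m ` (\<Union>j\<in>{..d}. ?I j)" unfolding i(2) by (intro imageI UN_I)
  qed
  then have "card {e \<in> std_cycle d m. v \<in> e} \<le> card (\<Union>j\<in>{..d}. ?I j)"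
    by (intro order_trans[OF card_mono card_image_le]) auto
  also have "\<dots> \<le> (\<Sum>j\<in>{..d}. card (?I j))" by (rule card_UN_le) simp
  also have "\<dots> \<le> (\<Sum>j\<in>{..d}. 1)" by (rule sum_mono) (rule one)
  finally show ?thesis by simp
qed

text \<open>This limits the possible images of an edge once the image of a neighbouring edge is
  known.\<close>

lemma card_std_cycle_meeting_le:
  assumes "2 \<le> d" "2 \<le> m" and "e \<in> std_cycle d m"
  shows "card {g \<in> std_cycle d m. g \<inter> e \<noteq> {}} \<le> (Suc d)\<^sup>2"
proof -
  have ce: "card e = Suc d" "finite e" using assms card_std_edge by (auto simp: std_cycle_def)
  have "{g \<in> std_cycle d m. g \<inter> e \<noteq> {}} = (\<Union>v\<in>e. {g \<in> std_cycle d m. v \<in> g})" by auto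
  then have "card {g \<in> std_cycle d m. g \<inter> e \<noteq> {}} \<le> (\<Sum>v\<in>e. card {g \<in> std_cycle d m. v \<in> g})"
    using card_UN_le[OF ce(2)] by metis
  also have "\<dots> \<le> (\<Sum>v\<in>e. Suc d)" using assms by (intro sum_mono card_std_cycle_at_le) auto
  finally show ?thesis by (simp add: ce power2_eq_square)
qed

section \<open>Target edges of runs in the cut-open cycle\<close>

text \<open>Records only where the edges go, not how their vertices are arranged, so that choosing
  targets and counting permutations with given targets become separate tasks. \<open>T\<close> holds
  offsets from the edge \<open>a\<close> at which the cycle is cut.\<close>

definition std_edge_images :: "nat \<Rightarrow> nat \<Rightarrow> nat \<Rightarrow> nat set \<Rightarrow> (nat \<Rightarrow> nat set) set" where
  "std_edge_images d m a T = (\<lambda>s. \<lambda>b\<in>T. s ` std_edge d m (a + b)) `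
     {s. s permutes {1..m * d} \<and> (\<forall>b\<in>T. s ` std_edge d m (a + b) \<in> std_cycle d m)}"

lemma finite_std_edge_images [simp]: "finite (std_edge_images d m a T)"
  by (simp add: std_edge_images_def finite_permutations)

lemma std_edge_images_in_std_cycle: "\<phi> \<in> std_edge_images d m a T \<Longrightarrow> b \<in> T \<Longrightarrow> \<phi> b \<in> std_cycle d m"
  by (auto simp: std_edge_images_def)

text \<open>If the preceding edge is also in \<open>T\<close>, its image shares a vertex with the
  new image, which leaves boundedly many targets; otherwise any of the \<open>m\<close> edges is
  allowed.\<close>

lemma card_std_edge_images_insert_le:
  assumes d: "2 \<le> d" and b: "1 \<le> b" "b < m" and T: "T \<subseteq> {1..<b}"
  shows "card (std_edge_images d m a (insert b T))
           \<le> card (std_edge_images d m a T) * (if b - 1 \<in> T then (Suc d)\<^sup>2 else m)"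
proof -
  let ?N = "\<lambda>\<phi>. {g \<in> std_cycle d m. b - 1 \<in> T \<longrightarrow> g \<inter> \<phi> (b - 1) \<noteq> {}}"
  let ?K = "if b - 1 \<in> T then (Suc d)\<^sup>2 else m"
  have "std_edge_images d m a (insert b T) \<subseteq> (\<Union>\<phi>\<in>std_edge_images d m a T. (\<lambda>g. \<phi>(b := g)) ` ?N \<phi>)"
  proof
    fix \<psi> assume "\<psi> \<in> std_edge_images d m a (insert b T)"
    then obtain s where s: "s permutes {1..m * d}" "\<And>c. c \<in> insert b T \<Longrightarrow> s ` std_edge d m (a + c) \<in> std_cycle d m"
      and \<psi>: "\<psi> = (\<lambda>c\<in>insert b T. s ` std_edge d m (a + c))"
      unfolding std_edge_images_def by blast
    define \<phi> where "\<phi> = (\<lambda>c\<in>T. s ` std_edge d m (a + c))"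
    have "\<phi> \<in> std_edge_images d m a T" using s by (auto simp: \<phi>_def std_edge_images_def)
    moreover have "\<psi> = \<phi>(b := s ` std_edge d m (a + b))"
      by (rule ext) (simp add: \<psi> \<phi>_def restrict_def)
    moreover have "s ` std_edge d m (a + b) \<inter> \<phi> (b - 1) \<noteq> {}" if "b - 1 \<in> T"
    proof -
      have "std_edge d m (a + (b - 1)) \<inter> std_edge d m (a + b) \<noteq> {}"
        by (subst std_edge_Int) (use that T b d in auto)
      then show ?thesis using that by (auto simp: \<phi>_def)
    qed
    moreover have "s ` std_edge d m (a + b) \<in> std_cycle d m" using s by simp
    ultimately show "\<psi> \<in> (\<Union>\<phi>\<in>std_edge_images d m a T. (\<lambda>g. \<phi>(b := g)) ` ?N \<phi>)"
      by (intro UN_I[of \<phi>] image_eqI[of _ _ "s ` std_edge d m (a + b)"]) simp_all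
  qed
  then have "card (std_edge_images d m a (insert b T)) \<le> card (\<Union>\<phi>\<in>std_edge_images d m a T. (\<lambda>g. \<phi>(b := g)) ` ?N \<phi>)"
    by (rule card_mono[rotated]) simp
  also have "\<dots> \<le> (\<Sum>\<phi>\<in>std_edge_images d m a T. card ((\<lambda>g. \<phi>(b := g)) ` ?N \<phi>))"
    by (rule card_UN_le) simp
  also have "\<dots> \<le> (\<Sum>\<phi>\<in>std_edge_images d m a T. ?K)"
  proof (rule sum_mono)
    fix \<phi> assume \<phi>: "\<phi> \<in> std_edge_images d m a T"
    have "card ((\<lambda>g. \<phi>(b := g)) ` ?N \<phi>) \<le> card (?N \<phi>)" by (rule card_image_le) simp
    also have "\<dots> \<le> ?K"
    proof (cases "b - 1 \<in> T")
      case True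
      have "card {g \<in> std_cycle d m. g \<inter> \<phi> (b - 1) \<noteq> {}} \<le> (Suc d)\<^sup>2"
        using b d True std_edge_images_in_std_cycle[OF \<phi> True] T by (intro card_std_cycle_meeting_le) auto
      then show ?thesis using True by simp
    next
      case False
      then show ?thesis using card_std_cycle[OF d, of m] by simp
    qed
    finally show "card ((\<lambda>g. \<phi>(b := g)) ` ?N \<phi>) \<le> ?K" .
  qed
  finally show ?thesis by simp
qed

text \<open>Since \<open>b\<close> exceeds all offsets in \<open>T\<close> and edge \<open>a\<close>
  is left out, the new edge can meet the earlier ones only in the vertex joining it to its
  predecessor.\<close>

lemma card_std_edge_union_insert_ge:
  assumes d: "2 \<le> d" and b: "1 \<le> b" "b < m" and T: "T \<subseteq> {1..<b}" and m: "2 \<le> m"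
  shows "card (\<Union>c\<in>insert b T. std_edge d m (a + c))
           \<ge> card (\<Union>c\<in>T. std_edge d m (a + c)) + (if b - 1 \<in> T then d else Suc d)"
proof -
  let ?U = "\<Union>c\<in>T. std_edge d m (a + c)"
  have fin: "finite ?U" using T finite_subset by (intro finite_UN_I) auto
  have each: "std_edge d m (a + c) \<inter> std_edge d m (a + b) =
      (if b = Suc c then {Suc ((a + b) * d mod (m * d))} else {})" if "c \<in> T" for c
    by (rule std_edge_Int) (use that T b d in auto)
  define v where "v = Suc ((a + b) * d mod (m * d))"
  have "?U \<inter> std_edge d m (a + b) = (\<Union>c\<in>T. std_edge d m (a + c) \<inter> std_edge d m (a + b))" by blast
  also have "\<dots> \<subseteq> (if b - 1 \<in> T then {v} else {})"
    unfolding UN_subset_iff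
  proof
    fix c assume c: "c \<in> T"
    show "std_edge d m (a + c) \<inter> std_edge d m (a + b) \<subseteq> (if b - 1 \<in> T then {v} else {})"
      unfolding each[OF c, folded v_def] using c b by simp
  qed
  finally have "card (?U \<inter> std_edge d m (a + b)) \<le> (if b - 1 \<in> T then 1 else 0)"
    by (auto simp: card_mono split: if_splits dest: card_mono[rotated])
  moreover have "card (?U \<union> std_edge d m (a + b)) + card (?U \<inter> std_edge d m (a + b)) = card ?U + Suc d"
    using card_Un_Int[OF fin, of "std_edge d m (a + b)"] card_std_edge[of d m] d m by simp
  moreover have "(\<Union>c\<in>insert b T. std_edge d m (a + c)) = ?U \<union> std_edge d m (a + b)" by auto
  ultimately show ?thesis by (auto split: if_splits)
qed

text \<open>Each connected run of edges costs one free choice of a position, which is exactly paid for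
  by the extra vertex that the run covers.\<close>

lemma card_std_edge_images_weight_le:
  assumes d: "2 \<le> d" and m: "2 \<le> m" and T: "T \<subseteq> {1..<m}"
  shows "card (std_edge_images d m a T) * (exp 1 / real (m * d)) ^ card (\<Union>c\<in>T. std_edge d m (a + c))
           \<le> ((Suc d)\<^sup>2 * exp 1 ^ Suc d / real (m * d) ^ d) ^ card T"
proof -
  have "finite T" using T finite_subset by blast
  then show ?thesis using T
  proof (induction T rule: finite_linorder_max_induct)
    case empty
    \<comment> \<open>Restriction to the empty set yields only the constant function
      \<open>undefined\<close>.\<close>
    have "card (std_edge_images d m a {}) \<le> card {\<lambda>b::nat. undefined :: nat set}"
      by (rule card_mono) (auto simp: std_edge_images_def)
    then show ?case by simp
  next
    case (insert b T)
    let ?n = "real (m * d)" and ?U = "\<lambda>T. card (\<Union>c\<in>T. std_edge d m (a + c))"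
    let ?x = "exp 1 / ?n"
    let ?y = "(Suc d)\<^sup>2 * exp 1 ^ Suc d / ?n ^ d"
    let ?I = "\<lambda>T. card (std_edge_images d m a T)"
    have b: "1 \<le> b" "b < m" "T \<subseteq> {1..<b}"
      using insert.hyps insert.prems by auto
    have IH: "?I T * ?x ^ ?U T \<le> ?y ^ card T" using insert.IH insert.prems by simp
    have "2 * 2 \<le> m * d" by (rule mult_le_mono[OF m d])
    then have n: "?n \<ge> 4" by linarith
    have x: "0 \<le> ?x" "?x \<le> 1" using n exp_le by auto
    let ?u = "if b - 1 \<in> T then d else Suc d" and ?K = "if b - 1 \<in> T then (Suc d)\<^sup>2 else m"
    \<comment> \<open>As \<open>e <= 3 < ?n\<close>, the base is at most \<open>1\<close>, so a
      lower bound on the covered vertices becomes an upper bound on the power.\<close>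
    have pow: "?x ^ ?U (insert b T) \<le> ?x ^ ?U T * ?x ^ ?u"
      unfolding power_add[symmetric] using x card_std_edge_union_insert_ge[OF d b m, of a] by (intro power_decreasing) auto
    \<comment> \<open>A continued run has \<open>(Suc d)\<^sup>2\<close> choices against
      \<open>d\<close> new vertices, a new run has \<open>m <= m * d\<close> choices against
      \<open>Suc d\<close> new vertices. Either way \<open>?n ^ d\<close> survives in the
      denominator.\<close>
    have step: "?K * ?x ^ ?u \<le> ?y"
    proof (cases "b - 1 \<in> T")
      case True
      have "?x ^ d \<le> exp 1 ^ Suc d / ?n ^ d"
        unfolding power_divide by (intro divide_right_mono power_increasing) auto
      from mult_left_mono[OF this, of "real ((Suc d)\<^sup>2)"] True show ?thesis by simp
    next
      case False
      have "m * 1 \<le> m * d" using d by (intro mult_le_mono2) simp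
      then have "real m \<le> ?n" unfolding mult_1_right by (rule of_nat_mono)
      then have "m * ?x ^ Suc d \<le> ?n * ?x ^ Suc d" using x by (intro mult_right_mono zero_le_power)
      also have "\<dots> = exp 1 ^ Suc d / ?n ^ d" using n d by (simp add: power_divide)
      also have "\<dots> = 1 * (exp 1 ^ Suc d / ?n ^ d)" by (simp only: mult_1)
      also have "\<dots> \<le> (Suc d)\<^sup>2 * (exp 1 ^ Suc d / ?n ^ d)"
      proof (rule mult_right_mono)
        have "1 \<le> (Suc d)\<^sup>2" by simp
        from of_nat_mono[OF this] show "1 \<le> real ((Suc d)\<^sup>2)" unfolding of_nat_1 .
      qed simp
      finally show ?thesis using False by simp
    qed
    have "?I (insert b T) * ?x ^ ?U (insert b T) \<le> real (?I T * ?K) * (?x ^ ?U T * ?x ^ ?u)"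
      using card_std_edge_images_insert_le[OF d b, of a] x pow by (intro mult_mono of_nat_mono zero_le_power) simp_all
    also have "\<dots> = (?I T * ?x ^ ?U T) * (?K * ?x ^ ?u)" by simp
    also have "\<dots> \<le> ?y ^ card T * ?y"
      by (intro mult_mono IH step) (use x in simp_all)
    also have "\<dots> = ?y ^ card (insert b T)"
      using insert.hyps by (subst card_insert_disjoint) auto
    finally show ?case .
  qed
qed

section \<open>Permutations that keep given edges in the cycle\<close>

text \<open>Divided by \<open>fact (m * d)\<close>, its size is the probability that the image of
  the cycle under the inverse of a uniform permutation contains \<open>S\<close>.\<close>

definition into_std_cycle :: "nat \<Rightarrow> nat \<Rightarrow> nat set set \<Rightarrow> (nat \<Rightarrow> nat) set" where
  "into_std_cycle d m S = {s. s permutes {1..m * d} \<and> (\<forall>e\<in>S. s ` e \<in> std_cycle d m)}"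

text \<open>The cycle is cut at an edge \<open>a\<close> outside \<open>S\<close>. Three counts are
  multiplied: the target tuples, \<open>fact (Suc d)\<close> arrangements for each edge, and the
  arrangements of the uncovered vertices, which are at most \<open>(e / n)^u * n!\<close> when
  \<open>u\<close> vertices are covered.\<close>

lemma card_into_std_cycle_proper_le:
  assumes d: "2 \<le> d" and m: "2 \<le> m" and S: "S \<subseteq> std_cycle d m" "S \<noteq> std_cycle d m"
  shows "card (into_std_cycle d m S)
           \<le> fact (m * d) * (fact (Suc d) * ((Suc d)\<^sup>2 * exp 1 ^ Suc d / real (m * d) ^ d)) ^ card S"
proof -
  let ?n = "m * d"
  have n: "?n > 0" using d m by simp
  obtain a where a: "a < m" "std_edge d m a \<notin> S" using S by (auto simp: std_cycle_def)
  define T where "T = {b \<in> {1..<m}. std_edge d m (a + b) \<in> S}"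
  let ?P = "\<lambda>b. std_edge d m (a + b)"
  have T: "T \<subseteq> {1..<m}" "finite T" by (auto simp: T_def)
  have inj: "inj_on ?P {1..<m}"
  proof (rule linorder_inj_onI')
    fix s b assume "s \<in> {1..<m}" "b \<in> {1..<m}" "s < b"
    then have "?P s \<inter> ?P b = (if b = Suc s then {Suc ((a + b) * d mod (m * d))} else {})"
      using d by (intro std_edge_Int) auto
    then have "card (?P s \<inter> ?P b) \<le> 1" by simp
    then show "?P s \<noteq> ?P b" using card_std_edge[of d m "a + b"] d m by auto
  qed
  have PT: "?P ` T = S"
  proof
    show "?P ` T \<subseteq> S" by (auto simp: T_def)
    show "S \<subseteq> ?P ` T"
    proof
      fix e assume e: "e \<in> S"
      then obtain i where i: "i < m" "e = std_edge d m i" using S by (auto simp: std_cycle_def)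
      have "i \<noteq> a" using a e i by auto
      \<comment> \<open>The offset of \<open>i\<close> from \<open>a\<close>, modulo
        \<open>m\<close>.\<close>
      define b where "b = (if a < i then i - a else i + m - a)"
      have "b \<in> {1..<m}" using \<open>i \<noteq> a\<close> i a by (auto simp: b_def)
      moreover have "?P b = e"
      proof (cases "a < i")
        case False
        then have "a + b = i + m" using i a by (simp add: b_def)
        then show ?thesis by (simp add: i std_edge_add_period)
      qed (simp add: b_def i)
      ultimately show "e \<in> ?P ` T" using e by (intro image_eqI[of _ _ b]) (auto simp: T_def)
    qed
  qed
  have cT: "card T = card S"
    using card_image[OF inj_on_subset[OF inj T(1)]] PT by simp
  let ?u = "card (\<Union>b\<in>T. ?P b)" and ?x = "exp 1 / real ?n"
  have sub: "?P b \<subseteq> {1..?n}" for b using d m by (intro std_edge_subset) auto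
  have u: "card ({1..?n} - \<Union>(?P ` T)) = ?n - ?u" "?u \<le> ?n"
  proof -
    have U: "(\<Union>b\<in>T. ?P b) \<subseteq> {1..?n}" using sub by blast
    show "card ({1..?n} - \<Union>(?P ` T)) = ?n - ?u"
      using card_Diff_subset[OF finite_subset[OF U] U] by simp
    show "?u \<le> ?n" using card_mono[OF _ U] by simp
  qed
  have cover: "into_std_cycle d m S \<subseteq>
      (\<Union>\<phi>\<in>std_edge_images d m a T. {s. s permutes {1..?n} \<and> (\<forall>b\<in>T. s ` ?P b = \<phi> b)})"
  proof
    fix s assume "s \<in> into_std_cycle d m S"
    then have s: "s permutes {1..?n}" "\<forall>b\<in>T. s ` ?P b \<in> std_cycle d m"
      unfolding into_std_cycle_def PT[symmetric] by auto
    then have "(\<lambda>b\<in>T. s ` ?P b) \<in> std_edge_images d m a T" by (auto simp: std_edge_images_def)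
    then show "s \<in> (\<Union>\<phi>\<in>std_edge_images d m a T. {s. s permutes {1..?n} \<and> (\<forall>b\<in>T. s ` ?P b = \<phi> b)})"
      by (rule UN_I) (use s(1) in auto)
  qed
  have "card (into_std_cycle d m S) \<le>
      card (\<Union>\<phi>\<in>std_edge_images d m a T. {s. s permutes {1..?n} \<and> (\<forall>b\<in>T. s ` ?P b = \<phi> b)})"
    by (rule card_mono[OF _ cover]) (auto intro: finite_subset[OF _ finite_permutations[of "{1..?n}"]])
  also have "\<dots> \<le> (\<Sum>\<phi>\<in>std_edge_images d m a T. card {s. s permutes {1..?n} \<and> (\<forall>b\<in>T. s ` ?P b = \<phi> b)})"
    by (rule card_UN_le) simp
  also have "\<dots> \<le> (\<Sum>\<phi>\<in>std_edge_images d m a T. fact (Suc d) ^ card T * fact (?n - ?u))"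
  proof (rule sum_mono)
    fix \<phi>
    have "card {s. s permutes {1..?n} \<and> (\<forall>b\<in>T. s ` ?P b = \<phi> b)}
        \<le> (\<Prod>b\<in>T. fact (card (?P b))) * fact (card ({1..?n} - \<Union>(?P ` T)))"
      using T sub by (intro card_permutes_prescribed_le) auto
    also have "\<dots> = fact (Suc d) ^ card T * fact (?n - ?u)"
      unfolding u(1) using d m by (simp add: card_std_edge del: fact_Suc)
    finally show "card {s. s permutes {1..?n} \<and> (\<forall>b\<in>T. s ` ?P b = \<phi> b)} \<le> fact (Suc d) ^ card T * fact (?n - ?u)" .
  qed
  also have "\<dots> = card (std_edge_images d m a T) * (fact (Suc d) ^ card T * fact (?n - ?u))"
    by (simp del: fact_Suc)
  finally have "real (card (into_std_cycle d m S)) \<le> real (card (std_edge_images d m a T) * (fact (Suc d) ^ card T * fact (?n - ?u)))"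
    by (rule of_nat_mono)
  also have "\<dots> = fact (Suc d) ^ card T * (real (card (std_edge_images d m a T)) * fact (?n - ?u))"
    by (simp only: of_nat_mult of_nat_power of_nat_fact mult_ac)
  also have "\<dots> \<le> fact (Suc d) ^ card T * (card (std_edge_images d m a T) * (?x ^ ?u * fact ?n))"
  proof (intro mult_left_mono)
    have "(?n / exp 1) ^ ?u * fact (?n - ?u) \<le> (fact ?n :: real)"
      by (rule power_divide_exp_le_fact[OF u(2)])
    then have "?x ^ ?u * ((?n / exp 1) ^ ?u * fact (?n - ?u)) \<le> ?x ^ ?u * (fact ?n :: real)"
      by (rule mult_left_mono) simp
    moreover have "?x ^ ?u * (?n / exp 1) ^ ?u = 1"
      unfolding power_mult_distrib[symmetric] using n by simp
    ultimately show "fact (?n - ?u) \<le> ?x ^ ?u * (fact ?n :: real)"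
      by (simp add: mult.assoc[symmetric])
  qed simp_all
  also have "\<dots> = fact (Suc d) ^ card T * fact ?n * (card (std_edge_images d m a T) * ?x ^ ?u)"
    by (simp add: mult_ac del: fact_Suc)
  also have "\<dots> \<le> fact (Suc d) ^ card T * fact ?n * ((Suc d)\<^sup>2 * exp 1 ^ Suc d / real ?n ^ d) ^ card T"
    by (rule mult_left_mono[OF card_std_edge_images_weight_le[OF d m T(1)]]) simp
  also have "\<dots> = fact ?n * (fact (Suc d) * ((Suc d)\<^sup>2 * exp 1 ^ Suc d / real ?n ^ d)) ^ card S"
    by (simp only: power_mult_distrib[of "fact (Suc d)"] cT mult_ac)
  finally show ?thesis .
qed

text \<open>The factors are the arrangements within an edge, the choices for the next target in a
  run, the loss in the falling factorial estimate, and a slack per edge that absorbs the case of the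
  full cycle.\<close>

definition overlap_const :: "nat \<Rightarrow> real" where
  "overlap_const d = fact (Suc d) * real ((Suc d)\<^sup>2) * exp 1 ^ Suc d * (2 * real d) ^ d"

lemma overlap_const_pos: "0 < d \<Longrightarrow> 0 < overlap_const d"
  unfolding overlap_const_def by (intro mult_pos_pos zero_less_power fact_gt_zero) simp_all

text \<open>Dropping one edge of the full cycle makes it a proper subset but loses one factor of
  order \<open>n^(-d)\<close>. Spread over \<open>m\<close> edges, this loss costs only a constant
  factor per edge.\<close>

lemma card_into_std_cycle_le:
  assumes d: "2 \<le> d" and m: "2 \<le> m" and S: "S \<subseteq> std_cycle d m"
  shows "card (into_std_cycle d m S) \<le> fact (m * d) * (overlap_const d / real (m * d) ^ d) ^ card S"
proof -
  let ?n = "real (m * d)"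
  define c where "c = fact (Suc d) * (real ((Suc d)\<^sup>2) * exp 1 ^ Suc d)"
  define B where "B = (2 * real d) ^ d"
  have c: "1 \<le> c"
  proof -
    have "1 * (1 * 1) \<le> c" unfolding c_def
      by (intro mult_mono one_le_power fact_ge_1) auto
    then show ?thesis by simp
  qed
  have B: "1 \<le> B" unfolding B_def using d by (intro one_le_power) simp
  have n: "0 < ?n" using d m by simp
  have A: "overlap_const d / ?n ^ d = B * (c / ?n ^ d)" by (simp add: overlap_const_def c_def B_def)
  have proper: "card (into_std_cycle d m S) \<le> fact (m * d) * (c / ?n ^ d) ^ card S"
    if "S \<subseteq> std_cycle d m" "S \<noteq> std_cycle d m" for S
    using card_into_std_cycle_proper_le[OF d m that] by (simp add: c_def)
  show ?thesis
  proof (cases "S = std_cycle d m")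
    case False
    have z: "0 \<le> c / ?n ^ d" using c by simp
    have "(c / ?n ^ d) ^ card S \<le> (B * (c / ?n ^ d)) ^ card S"
      using mult_right_mono[OF B z] z by (intro power_mono) simp_all
    then show ?thesis
      unfolding A using proper[OF S False] by (meson fact_ge_zero mult_left_mono order_trans)
  next
    case True
    have cS: "card S = m" using True d by (simp add: card_std_cycle)
    then obtain e where e: "e \<in> S" using m by fastforce
    have fin: "finite S" using True by simp
    have ce: "card (S - {e}) = m - 1" using e cS fin by simp
    \<comment> \<open>From \<open>m <= 2^m\<close> and \<open>d <= d^m\<close> follows
      \<open>m * d <= (2 * d)^m\<close>; hence the \<open>2 * d\<close> in
      \<open>overlap_const\<close>.\<close>
    have "?n ^ d \<le> B ^ m"
    proof -
      have "real m \<le> 2 ^ m" by (rule order_less_imp_le, rule of_nat_less_two_power)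
      moreover have "real d \<le> real d ^ m" using d m by (intro self_le_power) auto
      ultimately have "?n \<le> 2 ^ m * real d ^ m" unfolding of_nat_mult by (intro mult_mono) auto
      then have "?n ^ d \<le> (2 ^ m * real d ^ m) ^ d" by (rule power_mono) simp
      also have "\<dots> = B ^ m" unfolding B_def
        by (simp only: power_mult_distrib[symmetric] power_mult[symmetric] mult.commute)
      finally show ?thesis .
    qed
    also have "\<dots> \<le> B ^ m * c" using mult_left_mono[OF c, of "B ^ m"] B by simp
    finally have "?n ^ d \<le> B ^ m * c" .
    moreover have "0 < ?n ^ d" using n by (rule zero_less_power)
    ultimately have one: "1 \<le> B ^ m * (c / ?n ^ d)" unfolding times_divide_eq_right
      by (subst le_divide_eq_1_pos)
    have "into_std_cycle d m S \<subseteq> into_std_cycle d m (S - {e})" by (auto simp: into_std_cycle_def)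
    moreover have "finite (into_std_cycle d m (S - {e}))"
      by (rule finite_subset[OF _ finite_permutations[of "{1..m * d}"]]) (auto simp: into_std_cycle_def)
    ultimately have "real (card (into_std_cycle d m S)) \<le> card (into_std_cycle d m (S - {e}))"
      by (intro of_nat_mono card_mono)
    also have "\<dots> \<le> fact (m * d) * (c / ?n ^ d) ^ (m - 1)"
      using proper[of "S - {e}"] e True ce by auto
    also have "\<dots> \<le> fact (m * d) * (c / ?n ^ d) ^ (m - 1) * (B ^ m * (c / ?n ^ d))"
      using mult_left_mono[OF one, of "fact (m * d) * (c / ?n ^ d) ^ (m - 1)"] c by simp
    also have "\<dots> = fact (m * d) * (B ^ m * ((c / ?n ^ d) ^ (m - 1) * (c / ?n ^ d)))" by (simp only: mult_ac)
    also have "(c / ?n ^ d) ^ (m - 1) * (c / ?n ^ d) = (c / ?n ^ d) ^ m"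
      using m by (intro power_minus_mult) simp
    also have "B ^ m * (c / ?n ^ d) ^ m = (B * (c / ?n ^ d)) ^ m" by (simp only: power_mult_distrib)
    finally show ?thesis unfolding A cS .
  qed
qed

text \<open>No constant may be lost here, because this term has to match the squared covariance.
  There are \<open>m\<close> targets, each attained by \<open>(d + 1)! * (n - d - 1)!\<close>
  permutations, where \<open>n = m * d\<close>; multiplying by the binomial coefficient avoids a
  division.\<close>

lemma card_into_std_cycle_singleton_le:
  assumes d: "2 \<le> d" and m: "2 \<le> m" and e: "e \<in> std_cycle d m"
  shows "card (into_std_cycle d m {e}) * ((m * d) choose Suc d) \<le> m * fact (m * d)"
proof -
  let ?n = "m * d"
  have e': "e \<subseteq> {1..?n}" "card e = Suc d" "finite e"
    using e d m std_edge_subset[of d m] card_std_edge[of d m] by (auto simp: std_cycle_def)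
  then have le: "Suc d \<le> ?n" using card_mono[of "{1..?n}" e] by simp
  have "into_std_cycle d m {e} = (\<Union>g\<in>std_cycle d m. {s. s permutes {1..?n} \<and> (\<forall>i\<in>{e}. s ` i = g)})"
    by (auto simp: into_std_cycle_def)
  then have "card (into_std_cycle d m {e}) \<le> (\<Sum>g\<in>std_cycle d m. card {s. s permutes {1..?n} \<and> (\<forall>i\<in>{e}. s ` i = g)})"
    by (simp only: card_UN_le[OF finite_std_cycle])
  also have "\<dots> \<le> (\<Sum>g\<in>std_cycle d m. fact (Suc d) * fact (?n - Suc d))"
  proof (rule sum_mono)
    fix g
    show "card {s. s permutes {1..?n} \<and> (\<forall>i\<in>{e}. s ` i = g)} \<le> fact (Suc d) * fact (?n - Suc d)"
      using card_permutes_prescribed_le[of "{1..?n}" "{e}" "\<lambda>i. i" "\<lambda>_. g"] e'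
      by (simp add: card_Diff_subset del: fact_Suc)
  qed
  also have "\<dots> = m * (fact (Suc d) * fact (?n - Suc d))"
    using card_std_cycle[OF d] by simp
  finally have "card (into_std_cycle d m {e}) * (?n choose Suc d) \<le> m * (fact (Suc d) * fact (?n - Suc d)) * (?n choose Suc d)"
    by (rule mult_le_mono1)
  also have "\<dots> = m * (fact (Suc d) * fact (?n - Suc d) * (?n choose Suc d))" by (simp only: mult_ac)
  also have "\<dots> = m * fact ?n" using binomial_fact_lemma[OF le] by simp
  finally show ?thesis .
qed

section \<open>Exponential moment of the overlap\<close>

text \<open>The power is expanded over subsets of the overlap and the sums are exchanged. Singletons
  receive the exact count and all other sets the crude one; the empty set accounts for the
  \<open>- 1\<close>.\<close>

lemma sum_overlap_le:
  fixes q :: real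
  assumes d: "2 \<le> d" and m: "2 \<le> m" and q: "0 < q"
    and x: "x = q * overlap_const d * m / real (m * d) ^ d" "x \<le> 1"
  shows "(\<Sum>s | s permutes {1..m * d}. (1 + q) ^ card {e \<in> std_cycle d m. s ` e \<in> std_cycle d m} - 1)
           \<le> fact (m * d) * (q * (real m)\<^sup>2 / ((m * d) choose Suc d) + x\<^sup>2)"
proof -
  let ?n = "m * d"
  let ?G = "{s. s permutes {1..?n}}"
  define N where "N = real (?n choose Suc d)"
  define \<alpha> where "\<alpha> = overlap_const d / real ?n ^ d"
  let ?W = "\<lambda>S. real (card (into_std_cycle d m S))"
  let ?sing = "(\<lambda>e. {e}) ` std_cycle d m"
  have finG: "finite ?G" by (rule finite_permutations) simp
  have "2 * d \<le> ?n" using m by (rule mult_le_mono1)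
  then have "Suc d \<le> ?n" using d by linarith
  then have N: "0 < N" by (simp add: N_def del: mult_Suc)
  have \<alpha>: "0 \<le> \<alpha>" using overlap_const_pos[of d] d by (simp add: \<alpha>_def)
  have xm: "x = q * \<alpha> * m" by (simp add: x \<alpha>_def)
  have "(\<Sum>s\<in>?G. (1 + q) ^ card {e \<in> std_cycle d m. s ` e \<in> std_cycle d m}) =
      (\<Sum>s\<in>?G. \<Sum>S\<in>Pow (std_cycle d m). if s \<in> into_std_cycle d m S then q ^ card S else 0)"
  proof (rule sum.cong[OF refl])
    fix s assume s: "s \<in> ?G"
    let ?A = "{e \<in> std_cycle d m. s ` e \<in> std_cycle d m}"
    have "(1 + q) ^ card ?A = (\<Sum>S\<in>Pow ?A. q ^ card S)"
      by (rule sum_Pow_power_card[symmetric]) simp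
    also have "Pow ?A = {S \<in> Pow (std_cycle d m). s \<in> into_std_cycle d m S}"
      using s by (auto simp: into_std_cycle_def)
    also have "(\<Sum>S\<in>\<dots>. q ^ card S) = (\<Sum>S\<in>Pow (std_cycle d m). if s \<in> into_std_cycle d m S then q ^ card S else 0)"
      by (rule sum.inter_filter) simp
    finally show "(1 + q) ^ card ?A = (\<Sum>S\<in>Pow (std_cycle d m). if s \<in> into_std_cycle d m S then q ^ card S else 0)" .
  qed
  also have "\<dots> = (\<Sum>S\<in>Pow (std_cycle d m). \<Sum>s\<in>?G. if s \<in> into_std_cycle d m S then q ^ card S else 0)"
    by (rule sum.swap)
  also have "\<dots> = (\<Sum>S\<in>Pow (std_cycle d m). q ^ card S * ?W S)"
  proof (rule sum.cong[OF refl])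
    fix S
    have "{s \<in> ?G. s \<in> into_std_cycle d m S} = into_std_cycle d m S" by (auto simp: into_std_cycle_def)
    then show "(\<Sum>s\<in>?G. if s \<in> into_std_cycle d m S then q ^ card S else 0) = q ^ card S * ?W S"
      using finG by (simp add: sum.inter_filter[symmetric])
  qed
  also have "\<dots> = (\<Sum>S\<in>Pow (std_cycle d m) - ?sing. q ^ card S * ?W S) + (\<Sum>S\<in>?sing. q ^ card S * ?W S)"
    by (rule sum.subset_diff) auto
  also have "(\<Sum>S\<in>?sing. q ^ card S * ?W S) = (\<Sum>e\<in>std_cycle d m. q * ?W {e})"
    by (subst sum.reindex) auto
  also have "\<dots> \<le> (\<Sum>e\<in>std_cycle d m. q * (m * fact ?n / N))"
  proof (intro sum_mono mult_left_mono)
    fix e assume "e \<in> std_cycle d m"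
    from of_nat_mono[OF card_into_std_cycle_singleton_le[OF d m this], where 'a = real]
    have "?W {e} * N \<le> m * fact ?n"
      by (simp only: of_nat_mult of_nat_fact N_def)
    then show "?W {e} \<le> m * fact ?n / N" using N by (simp add: pos_le_divide_eq)
  qed (use q in simp)
  also have "\<dots> = fact ?n * (q * (real m)\<^sup>2 / N)"
    using card_std_cycle[OF d, of m] by (simp add: power2_eq_square)
  also have "(\<Sum>S\<in>Pow (std_cycle d m) - ?sing. q ^ card S * ?W S) \<le> (\<Sum>S\<in>Pow (std_cycle d m) - ?sing. fact ?n * (q * \<alpha>) ^ card S)"
  proof (rule sum_mono)
    fix S assume "S \<in> Pow (std_cycle d m) - ?sing"
    then have "?W S \<le> fact ?n * \<alpha> ^ card S"
      unfolding \<alpha>_def by (intro card_into_std_cycle_le d m) auto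
    from mult_left_mono[OF this, of "q ^ card S"]
    show "q ^ card S * ?W S \<le> fact ?n * (q * \<alpha>) ^ card S"
      using q by (simp add: power_mult_distrib mult_ac)
  qed
  also have "\<dots> = fact ?n * (\<Sum>S\<in>Pow (std_cycle d m) - ?sing. (q * \<alpha>) ^ card S)"
    by (simp add: sum_distrib_left)
  \<comment> \<open>Completing the crude sum to the whole power set makes it the power
    \<open>(1 + x / m) ^ m\<close>; the singletons to be removed again are its linear term
    \<open>x\<close>.\<close>
  also have "(\<Sum>S\<in>Pow (std_cycle d m) - ?sing. (q * \<alpha>) ^ card S) =
      (\<Sum>S\<in>Pow (std_cycle d m). (q * \<alpha>) ^ card S) - (\<Sum>S\<in>?sing. (q * \<alpha>) ^ card S)"
    by (rule sum_diff) auto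
  also have "(\<Sum>S\<in>?sing. (q * \<alpha>) ^ card S) = (\<Sum>e\<in>std_cycle d m. q * \<alpha>)"
    by (subst sum.reindex) auto
  also have "\<dots> = x" using card_std_cycle[OF d, of m] by (simp add: xm)
  also have "(\<Sum>S\<in>Pow (std_cycle d m). (q * \<alpha>) ^ card S) = (1 + x / m) ^ m"
    using card_std_cycle[OF d, of m] m by (subst sum_Pow_power_card) (simp_all add: xm)
  also have "(1 + x / m) ^ m - x \<le> 1 + x\<^sup>2"
    using power_one_plus_le_quadratic[of x m] x(2) q \<alpha> by (simp add: xm)
  finally have "(\<Sum>s\<in>?G. (1 + q) ^ card {e \<in> std_cycle d m. s ` e \<in> std_cycle d m}) \<le>
      fact ?n * (1 + x\<^sup>2) + fact ?n * (q * (real m)\<^sup>2 / N)" by simp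
  moreover have "real (card ?G) = fact ?n"
    using card_permutations[of "{1..?n}"] by simp
  ultimately show ?thesis
    by (simp add: sum_subtractf N_def distrib_left)
qed


section \<open>Counting loose Hamilton cycles by permutations\<close>

text \<open>Orderings and permutations carry the same data through
  \<open>vs ! x = s (Suc x)\<close>; the shift is between positions counted from 0 and vertices
  counted from 1.\<close>

lemma loose_Hamilton_cycle_iff:
  assumes "0 < d" "0 < m"
  shows "loose_Hamilton_cycle (Suc d) (m * d) C \<longleftrightarrow> (\<exists>s. s permutes {1..m * d} \<and> C = (`) s ` std_cycle d m)"
proof -
  let ?n = "m * d"
  have n: "0 < ?n" using assms by simp
  have edge: "s ` std_edge d m i = loose_edge (Suc d) ?n vs i" if "\<And>x. x < ?n \<Longrightarrow> vs ! x = s (Suc x)" for s vs i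
  proof -
    have "(\<lambda>j. i * d + j) ` {..<Suc d} = {i * d..i * d + d}"
      by (simp add: lessThan_Suc_atMost atMost_atLeast0)
    then have "std_edge d m i = (\<lambda>j. Suc ((i * d + j) mod ?n)) ` {..<Suc d}"
      unfolding std_edge_def by (simp only: image_image flip: \<open>_ = {i * d..i * d + d}\<close>)
    then show ?thesis using that n by (simp add: loose_edge_def image_image)
  qed
  have cycle: "(`) s ` std_cycle d m = loose_edge (Suc d) ?n vs ` {..<m}" if "\<And>x. x < ?n \<Longrightarrow> vs ! x = s (Suc x)" for s vs
    unfolding std_cycle_def image_image using edge[OF that] by simp
  have div: "?n div d = m" using assms by simp
  show ?thesis
  proof
    assume "loose_Hamilton_cycle (Suc d) ?n C"
    then obtain vs where vs: "vs \<in> permutations_of_set {1..?n}" and C: "C = loose_edge (Suc d) ?n vs ` {..<m}"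
      by (auto simp: loose_Hamilton_cycle_def div)
    have vs': "distinct vs" "set vs = {1..?n}" "length vs = ?n"
      using permutations_of_setD[OF vs] length_finite_permutations_of_set[OF vs] by auto
    define s where "s x = (if x \<in> {1..?n} then vs ! (x - 1) else x)" for x
    have "s permutes {1..?n}"
    proof (rule bij_imp_permutes)
      have "bij_betw (\<lambda>x. x - 1) {1..?n} {..<?n}"
        by (rule bij_betwI[of _ _ _ Suc]) auto
      then have "bij_betw ((!) vs \<circ> (\<lambda>x. x - 1)) {1..?n} {1..?n}"
        by (rule bij_betw_trans[OF _ bij_betw_nth]) (simp_all add: vs')
      then show "bij_betw s {1..?n} {1..?n}"
        by (rule bij_betw_cong[THEN iffD1, rotated]) (simp add: s_def)
    qed (auto simp: s_def)
    moreover have "C = (`) s ` std_cycle d m"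
      unfolding C by (rule cycle[symmetric]) (simp add: s_def)
    ultimately show "\<exists>s. s permutes {1..?n} \<and> C = (`) s ` std_cycle d m" by blast
  next
    assume "\<exists>s. s permutes {1..?n} \<and> C = (`) s ` std_cycle d m"
    then obtain s where s: "s permutes {1..?n}" and C: "C = (`) s ` std_cycle d m" by blast
    define vs where "vs = map s [1..<Suc ?n]"
    have "C = loose_edge (Suc d) ?n vs ` {..<m}"
      unfolding C by (rule cycle) (simp add: vs_def del: upt_Suc)
    moreover have "vs \<in> permutations_of_set {1..?n}"
      using permutes_image[OF s] permutes_inj_on[OF s]
      by (intro permutations_of_setI) (auto simp: vs_def distinct_map atLeastLessThanSuc_atLeastAtMost simp del: upt_Suc)
    ultimately show "loose_Hamilton_cycle (Suc d) ?n C"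
      by (auto simp: loose_Hamilton_cycle_def div)
  qed
qed

lemma inj_image_fun: "inj f \<Longrightarrow> inj ((`) f)"
  by (rule injI) (simp add: inj_image_eq_iff)

text \<open>The permutations producing one given cycle form a left coset of the stabilizer of the
  standard cycle, so every cycle is counted equally often.\<close>

lemma sum_permutes_eq_num_loose_Hamilton:
  assumes d: "0 < d" and m: "0 < m"
  shows "(\<Sum>s | s permutes {1..m * d}. of_bool ((`) s ` std_cycle d m \<subseteq> H)) =
           real (card {s. s permutes {1..m * d} \<and> (`) s ` std_cycle d m = std_cycle d m}) * num_loose_Hamilton (Suc d) (m * d) H"
proof -
  let ?V = "{1..m * d}"
  let ?C = "\<lambda>s. (`) s ` std_cycle d m"
  let ?G = "{s. s permutes ?V}"
  have finG: "finite ?G" by (rule finite_permutations) simp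
  let ?R = "{C. C \<subseteq> H \<and> loose_Hamilton_cycle (Suc d) (m * d) C}"
  have R: "?R = ?C ` {s \<in> ?G. ?C s \<subseteq> H}"
    using loose_Hamilton_cycle_iff[OF d m] by auto
  have "(\<Sum>s\<in>?G. of_bool (?C s \<subseteq> H)) = real (card {s \<in> ?G. ?C s \<subseteq> H})"
    using finG by (subst sum_of_bool_eq) (auto simp: Int_def)
  also have "card {s \<in> ?G. ?C s \<subseteq> H} = (\<Sum>C\<in>?R. card {s \<in> {s \<in> ?G. ?C s \<subseteq> H}. ?C s = C})"
    unfolding R using finG by (subst card_eq_sum, subst sum.image_gen[where g = ?C]) auto
  also have "\<dots> = (\<Sum>C\<in>?R. card {s. s permutes ?V \<and> ?C s = std_cycle d m})"
  proof (rule sum.cong[OF refl])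
    fix C assume "C \<in> ?R"
    then have "C \<in> ?C ` {s \<in> ?G. ?C s \<subseteq> H}" unfolding R .
    then obtain t where "C = ?C t" "t \<in> {s \<in> ?G. ?C s \<subseteq> H}" by (rule imageE)
    then have t: "t permutes ?V" "C = ?C t" "C \<subseteq> H" by simp_all
    have "?C (t \<circ> s) = ?C t \<longleftrightarrow> ?C s = std_cycle d m" for s
    proof -
      have "?C (t \<circ> s) = (`) t ` ?C s" by (simp only: image_image comp_def)
      moreover have "inj ((`) t)" using permutes_inj[OF t(1)] by (rule inj_image_fun)
      ultimately show ?thesis by (simp add: inj_image_eq_iff)
    qed
    then have "card {s. s permutes ?V \<and> ?C s = std_cycle d m} = card {s. s permutes ?V \<and> ?C s = ?C t}"
      using card_permutes_comp_cong[OF t(1), of "\<lambda>s. ?C s = ?C t"] by simp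
    also have "{s. s permutes ?V \<and> ?C s = ?C t} = {s \<in> {s \<in> ?G. ?C s \<subseteq> H}. ?C s = C}"
    proof (intro Collect_cong iffI conjI)
      fix s assume "s permutes ?V \<and> ?C s = ?C t"
      with t show "s \<in> {s \<in> ?G. ?C s \<subseteq> H}" "?C s = C" by simp_all
    qed (simp_all add: t(2))
    finally show "card {s \<in> {s \<in> ?G. ?C s \<subseteq> H}. ?C s = C} = card {s. s permutes ?V \<and> ?C s = std_cycle d m}" by simp
  qed
  finally show ?thesis by (simp add: num_loose_Hamilton_def mult.commute)
qed

section \<open>The random hypergraph and the overlap of two copies\<close>

lemma finite_all_edges [simp]: "finite (all_edges k n)"
  by (rule finite_subset[of _ "Pow {1..n}"]) (auto simp: all_edges_def)

lemma card_all_edges: "card (all_edges k n) = n choose k"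
  unfolding all_edges_def using n_subsets[of "{1..n}" k] by simp

lemma finite_set_random_hypergraph: "finite (set_pmf (random_hypergraph k n p))"
  unfolding random_hypergraph_def
  by (rule finite_subset[of _ "Pow (all_edges k n)"]) auto

lemma expectation_contains_random_hypergraph:
  fixes p :: real
  assumes A: "A \<subseteq> all_edges k n" and p: "0 \<le> p" "p \<le> 1"
  shows "measure_pmf.expectation (random_hypergraph k n p) (\<lambda>H. of_bool (A \<subseteq> H)) = p ^ card A"
proof -
  let ?E = "all_edges k n"
  let ?P = "Pi_pmf ?E False (\<lambda>_. bernoulli_pmf p)"
  have finA: "finite A" using A by (rule finite_subset) simp
  \<comment> \<open>Edges outside \<open>A\<close> contribute factors \<open>1\<close>, so that the
    product runs over the whole family of independent coins.\<close>
  have "measure_pmf.expectation (random_hypergraph k n p) (\<lambda>H. of_bool (A \<subseteq> H) :: real) =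
      measure_pmf.expectation ?P (\<lambda>b. \<Prod>e\<in>?E. if e \<in> A then of_bool (b e) else 1)"
    unfolding random_hypergraph_def integral_map_pmf
  proof (intro arg_cong[where f = "measure_pmf.expectation ?P"] ext)
    fix b
    have "(\<Prod>e\<in>?E. if e \<in> A then of_bool (b e) else (1::real)) = (\<Prod>e\<in>A. of_bool (b e))"
      using A by (simp add: prod.inter_restrict[symmetric] Int_absorb1)
    also have "\<dots> = of_bool (A \<subseteq> {e \<in> ?E. b e})"
      using finA A by (cases "\<forall>e\<in>A. b e") (auto simp: subset_iff)
    finally show "of_bool (A \<subseteq> {e \<in> ?E. b e}) = (\<Prod>e\<in>?E. if e \<in> A then of_bool (b e) else (1::real))" by simp
  qed
  also have "\<dots> = (\<Prod>e\<in>?E. measure_pmf.expectation (bernoulli_pmf p) (\<lambda>y. if e \<in> A then of_bool y else 1))"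
    by (rule expectation_prod_Pi_pmf) (auto intro: integrable_measure_pmf_finite)
  also have "\<dots> = (\<Prod>e\<in>?E. if e \<in> A then p else 1)"
    using p by (intro prod.cong refl) (simp add: expectation_bernoulli_pmf_real)
  also have "\<dots> = p ^ card A" using A by (simp add: prod.inter_restrict[symmetric] Int_absorb1)
  finally show ?thesis .
qed

text \<open>Substituting \<open>s \<circ> t\<close> for \<open>t\<close> moves the first copy back
  to the standard cycle, so the inner sum does not depend on \<open>s\<close>.\<close>

lemma sum_overlap_pairs:
  fixes F :: "nat \<Rightarrow> real"
  shows "(\<Sum>s | s permutes {1..m * d}. \<Sum>t | t permutes {1..m * d}. F (card ((`) s ` std_cycle d m \<inter> (`) t ` std_cycle d m)))
           = fact (m * d) * (\<Sum>s | s permutes {1..m * d}. F (card {e \<in> std_cycle d m. s ` e \<in> std_cycle d m}))"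
proof -
  let ?G = "{s. s permutes {1..m * d}}"
  let ?C = "\<lambda>s. (`) s ` std_cycle d m"
  have "(\<Sum>t\<in>?G. F (card (?C s \<inter> ?C t))) = (\<Sum>t\<in>?G. F (card {e \<in> std_cycle d m. t ` e \<in> std_cycle d m}))"
    if s: "s permutes {1..m * d}" for s
  proof -
    have inj: "inj ((`) u)" if "u permutes {1..m * d}" for u
      using permutes_inj[OF that] by (rule inj_image_fun)
    have "(\<Sum>t\<in>?G. F (card (?C s \<inter> ?C t))) = (\<Sum>t\<in>?G. F (card (?C s \<inter> ?C (s \<circ> t))))"
      by (rule setum_permutations_compose_left[OF s])
    also have "\<dots> = (\<Sum>t\<in>?G. F (card {e \<in> std_cycle d m. t ` e \<in> std_cycle d m}))"
    proof (rule sum.cong[OF refl])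
      fix t assume t: "t \<in> ?G"
      have "?C s \<inter> ?C (s \<circ> t) = (`) s ` (std_cycle d m \<inter> ?C t)"
        unfolding image_Int[OF inj[OF s]] by (simp only: image_image comp_def)
      also have "card \<dots> = card (std_cycle d m \<inter> ?C t)"
        by (rule card_image[OF inj_on_subset[OF inj[OF s]]]) simp
      also have "std_cycle d m \<inter> ?C t = (`) t ` {e \<in> std_cycle d m. t ` e \<in> std_cycle d m}" by auto
      also have "card \<dots> = card {e \<in> std_cycle d m. t ` e \<in> std_cycle d m}"
        using t by (intro card_image inj_on_subset[OF inj]) auto
      finally show "F (card (?C s \<inter> ?C (s \<circ> t))) = F (card {e \<in> std_cycle d m. t ` e \<in> std_cycle d m})" by simp
    qed
    finally show ?thesis .
  qed
  then show ?thesis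
    using card_permutations[of "{1..m * d}" "m * d"] by simp
qed

section \<open>Quantitative closeness of the standardized counts\<close>

lemma standardized_num_loose_Hamilton_close:
  fixes p :: real
  assumes d: "2 \<le> d" and m: "2 \<le> m" and p: "0 < p" "p < 1"
    and x: "(1 / p - 1) * overlap_const d \<le> m"
  defines "n \<equiv> m * d" and "N \<equiv> real ((m * d) choose Suc d)"
  shows "measure_pmf.expectation (random_hypergraph (Suc d) n p) (\<lambda>H.
      ((num_loose_Hamilton (Suc d) n H - loose_Hamilton_mean (Suc d) n p) / loose_Hamilton_sd (Suc d) n p
        - ((\<Sum>e\<in>all_edges (Suc d) n. of_bool ({e} \<subseteq> H)) - N * p) / sqrt (N * (p * (1 - p))))\<^sup>2)
    \<le> 2 * (1 / p - 1) * (overlap_const d)\<^sup>2 / m"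
proof -
  let ?M = "random_hypergraph (Suc d) n p"
  let ?C = "\<lambda>s. (`) s ` std_cycle d m"
  let ?G = "{s. s permutes {1..n}}"
  let ?E = "measure_pmf.expectation ?M :: (nat set set \<Rightarrow> real) \<Rightarrow> real"
  define q where "q = 1 / p - 1"
  define A where "A = overlap_const d"
  define y where "y = q * A * m / real n ^ d"
  have q: "0 < q" using p by (simp add: q_def)
  have A: "0 < A" using overlap_const_pos[of d] d by (simp add: A_def)
  have "m * 1 \<le> n" unfolding n_def using d by (intro mult_le_mono2) simp
  then have mn: "real m \<le> real n" "0 < real n" using m by simp_all
  have "2 * d \<le> n" unfolding n_def using m by (rule mult_le_mono1)
  then have dn: "Suc d \<le> n" using d by linarith
  then have N: "0 < N" by (simp add: N_def n_def)
  have cardE: "real (card (all_edges (Suc d) n)) = N" by (simp add: card_all_edges N_def n_def)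
  \<comment> \<open>The assumed lower bound on \<open>m\<close> enters here; it brings
    \<open>y\<close> into the range of the quadratic remainder estimate.\<close>
  have y1: "y \<le> 1"
  proof -
    have "q * A * m \<le> real m * m" using x by (intro mult_right_mono) (simp_all add: q_def A_def)
    also have "\<dots> \<le> real n * n" using mn by (intro mult_mono) auto
    also have "\<dots> \<le> real n ^ d" unfolding power2_eq_square[symmetric] using mn d m by (intro power_increasing) auto
    finally show ?thesis using mn by (simp add: y_def)
  qed
  define X where "X = (\<lambda>H. \<Sum>s\<in>?G. of_bool (?C s \<subseteq> H) :: real)"
  have finG: "finite ?G" by (rule finite_permutations) simp
  have cardG: "real (card ?G) = fact n" using card_permutations[of "{1..n}" n] by simp
  have sub: "?C s \<subseteq> all_edges (Suc d) n" if "s \<in> ?G" for s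
  proof
    fix e assume "e \<in> ?C s"
    then obtain i where e: "e = s ` std_edge d m i" by (auto simp: std_cycle_def)
    have sub: "std_edge d m i \<subseteq> {1..n}" unfolding n_def using d m by (intro std_edge_subset) auto
    have s: "s permutes {1..n}" using that by simp
    have "e \<subseteq> {1..n}" using image_mono[OF sub, of s] permutes_image[OF s] by (simp only: e)
    moreover have "card e = Suc d"
      unfolding e card_image[OF permutes_inj_on[OF s]] using d m by (intro card_std_edge) auto
    ultimately show "e \<in> all_edges (Suc d) n" unfolding all_edges_def by simp
  qed
  have cardC: "card (?C s) = m" if "s \<in> ?G" for s
  proof -
    have "inj s" using that permutes_inj by blast
    then have "inj_on ((`) s) (std_cycle d m)" by (rule inj_on_subset[OF inj_image_fun]) simp
    then show ?thesis using card_std_cycle[OF d] by (simp add: card_image)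
  qed
  have overlap: "(\<Sum>s\<in>?G. \<Sum>t\<in>?G. (1 / p) ^ card (?C s \<inter> ?C t) - 1)
      \<le> (real (card ?G))\<^sup>2 * ((1 / p - 1) * (real m)\<^sup>2 / card (all_edges (Suc d) n) + y\<^sup>2)"
  proof -
    have "(\<Sum>s\<in>?G. \<Sum>t\<in>?G. (1 / p) ^ card (?C s \<inter> ?C t) - 1) =
        fact n * (\<Sum>s\<in>?G. (1 + q) ^ card {e \<in> std_cycle d m. s ` e \<in> std_cycle d m} - 1)"
      using sum_overlap_pairs[where F = "\<lambda>i. (1 + q) ^ i - 1" and m = m and d = d] by (simp add: n_def q_def)
    also have "\<dots> \<le> fact n * (fact n * (q * (real m)\<^sup>2 / N + y\<^sup>2))"
      unfolding n_def N_def
      by (intro mult_left_mono sum_overlap_le d m q y1) (simp_all add: y_def A_def n_def)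
    finally show ?thesis unfolding cardG cardE q_def by (simp add: power2_eq_square mult.assoc)
  qed
  have close: "?E (\<lambda>H. ((X H - ?E X) / sqrt (measure_pmf.variance ?M X)
      - ((\<Sum>e\<in>all_edges (Suc d) n. of_bool ({e} \<subseteq> H)) - N * p) / sqrt (N * (p * (1 - p))))\<^sup>2)
    \<le> 2 * N * y\<^sup>2 / (q * (real m)\<^sup>2)"
  proof -
    have ne: "all_edges (Suc d) n \<noteq> {}" using cardE N by auto
    have neG: "?G \<noteq> {}" using permutes_id by blast
    have "1 \<le> m" using m by simp
    from standardized_distance_le[OF finite_set_random_hypergraph finite_all_edges ne
        expectation_contains_random_hypergraph p finG neG sub cardC this overlap] p
    show ?thesis unfolding X_def cardE q_def by (simp add: cardE)
  qed
  \<comment> \<open>The order of the stabilizer is the constant between \<open>X\<close> and the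
    number of cycles; being positive, it cancels in the standardization.\<close>
  define r where "r = real (card {s. s permutes {1..n} \<and> ?C s = std_cycle d m})"
  have X: "X = (\<lambda>H. r * num_loose_Hamilton (Suc d) n H)"
    unfolding X_def r_def n_def using d m by (intro ext sum_permutes_eq_num_loose_Hamilton) auto
  have "r > 0"
  proof -
    let ?S = "{s. s permutes {1..n} \<and> ?C s = std_cycle d m}"
    have "id \<in> ?S" by (simp add: permutes_id)
    then have "?S \<noteq> {}" by blast
    moreover have "finite ?S" using finG by simp
    ultimately show ?thesis unfolding r_def of_nat_0_less_iff card_gt_0_iff by blast
  qed
  have EX: "?E X = r * loose_Hamilton_mean (Suc d) n p"
    by (simp add: X loose_Hamilton_mean_def)
  have "measure_pmf.variance ?M X = r\<^sup>2 * measure_pmf.variance ?M (num_loose_Hamilton (Suc d) n)"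
  proof -
    have "(X H - ?E X)\<^sup>2 = r\<^sup>2 * (num_loose_Hamilton (Suc d) n H - ?E (num_loose_Hamilton (Suc d) n))\<^sup>2" for H
      unfolding EX unfolding X loose_Hamilton_mean_def
      by (simp add: power_mult_distrib flip: right_diff_distrib)
    then show ?thesis by simp
  qed
  then have sd: "sqrt (measure_pmf.variance ?M X) = r * loose_Hamilton_sd (Suc d) n p"
    using \<open>r > 0\<close> by (simp add: loose_Hamilton_sd_def real_sqrt_mult)
  have std: "(X H - ?E X) / sqrt (measure_pmf.variance ?M X) =
      (num_loose_Hamilton (Suc d) n H - loose_Hamilton_mean (Suc d) n p) / loose_Hamilton_sd (Suc d) n p" for H
    unfolding sd unfolding EX unfolding X using \<open>r > 0\<close> by (simp flip: right_diff_distrib)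
  have "2 * N * y\<^sup>2 / (q * (real m)\<^sup>2) = 2 * q * A\<^sup>2 * (N / (real n ^ d)\<^sup>2)"
    using q m by (simp add: y_def power_divide power_mult_distrib power2_eq_square)
  also have "\<dots> \<le> 2 * q * A\<^sup>2 * (1 / m)"
  proof (rule mult_left_mono)
    have "N \<le> real n ^ Suc d"
      unfolding N_def n_def of_nat_power[symmetric] of_nat_le_iff using dn by (intro binomial_le_pow) (simp add: n_def)
    have "N * m \<le> real n ^ Suc d * n" using \<open>N \<le> real n ^ Suc d\<close> mn by (intro mult_mono) auto
    also have "\<dots> = real n ^ (d + 2)" by simp
    \<comment> \<open>This is where \<open>k >= 3\<close> decides: \<open>d + 2 <= 2 * d\<close>
      makes the relative error of the variance \<open>O(1 / m)\<close>.\<close>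
    also have "\<dots> \<le> real n ^ (d + d)" using mn d m by (intro power_increasing) auto
    also have "\<dots> = (real n ^ d)\<^sup>2" by (simp add: power_add power2_eq_square)
    finally show "N / (real n ^ d)\<^sup>2 \<le> 1 / m" using mn m by (simp add: field_simps)
  qed (use q in simp)
  finally show ?thesis using close unfolding std by (simp add: q_def A_def)
qed

theorem theorem1p7:
  fixes p :: real and k :: nat
  assumes "0 < p" and "p < 1" and "3 \<le> k"
  shows "weak_conv_m
           (\<lambda>m. let n = m * (k - 1) in
              distr (measure_pmf (random_hypergraph k n p)) borel
                (\<lambda>H. (num_loose_Hamilton k n H - loose_Hamilton_mean k n p)
                      / loose_Hamilton_sd k n p))
           std_normal_distribution"
proof -
  define d where "d = k - 1"
  have k: "k = Suc d" "k - 1 = d" and d: "2 \<le> d" using assms by (auto simp: d_def)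
  let ?M = "\<lambda>m. random_hypergraph k (m * d) p"
  let ?E = "\<lambda>m. all_edges k (m * d)"
  let ?N = "\<lambda>m. real ((m * d) choose Suc d)"
  define Z where "Z m H = (num_loose_Hamilton k (m * d) H - loose_Hamilton_mean k (m * d) p)
      / loose_Hamilton_sd k (m * d) p" for m H
  define Y where "Y m H = ((\<Sum>e\<in>?E m. of_bool ({e} \<subseteq> H)) - ?N m * p) / sqrt (?N m * (p * (1 - p)))" for m H
  have "filterlim (\<lambda>m. (m * d) choose Suc d) at_top sequentially"
  proof (rule filterlim_at_top_mono[OF filterlim_ident])
    show "\<forall>\<^sub>F m in sequentially. m \<le> (m * d) choose Suc d"
    \<comment> \<open>The binomial coefficient is at least \<open>(m / 2) ^ Suc d\<close>, and
      \<open>(m / 2)\<^sup>2 >= m\<close> from \<open>m = 4\<close> on.\<close>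
    proof (rule eventually_sequentiallyI[of 4])
      fix m :: nat assume m: "4 \<le> m"
      have "2 * d \<le> m * d" using m by (intro mult_le_mono1) simp
      then have le: "Suc d \<le> m * d" using d by linarith
      have "m * Suc d \<le> m * (d * 2)" using d by (intro mult_le_mono2) simp
      from of_nat_mono[OF this, where 'a = real]
      have ge: "real m / 2 \<le> real (m * d) / real (Suc d)"
        by (simp add: field_simps)
      have "real m * 4 \<le> real m * m" using m by (intro mult_left_mono) auto
      then have "real m \<le> (real m / 2)\<^sup>2" by (simp add: power2_eq_square)
      also have "\<dots> \<le> (real m / 2) ^ Suc d" using d m by (intro power_increasing) auto
      also have "\<dots> \<le> (real (m * d) / real (Suc d)) ^ Suc d" using ge by (intro power_mono) auto
      also have "\<dots> \<le> real ((m * d) choose Suc d)" by (rule binomial_ge_n_over_k_pow_k[OF le])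
      finally show "m \<le> (m * d) choose Suc d" by linarith
    qed
  qed
  then have "weak_conv_m (\<lambda>m. distr (measure_pmf (Pi_pmf (?E m) False (\<lambda>_. bernoulli_pmf p))) borel
           (\<lambda>b. (real (card {e \<in> ?E m. b e}) - card (?E m) * p) / sqrt (card (?E m) * (p * (1 - p)))))
           std_normal_distribution"
    using assms by (intro binomial_central_limit) (simp_all add: card_all_edges k)
  \<comment> \<open>The limit law is carried over from the coins to the hypergraph, where the edge
    count has the form used for the distance estimate.\<close>
  also have "(\<lambda>m. distr (measure_pmf (Pi_pmf (?E m) False (\<lambda>_. bernoulli_pmf p))) borel
      (\<lambda>b. (real (card {e \<in> ?E m. b e}) - card (?E m) * p) / sqrt (card (?E m) * (p * (1 - p))))) =
      (\<lambda>m. distr (measure_pmf (?M m)) borel (Y m))"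
  proof
    fix m
    have "(\<Sum>e\<in>?E m. of_bool ({e} \<subseteq> {e \<in> ?E m. b e})) = real (card {e \<in> ?E m. b e})" for b
      by (subst sum_of_bool_eq) (auto simp: Int_def intro: arg_cong[where f = card])
    then have "(\<lambda>b. (real (card {e \<in> ?E m. b e}) - card (?E m) * p) / sqrt (card (?E m) * (p * (1 - p))))
        = (\<lambda>b. Y m {e \<in> ?E m. b e})"
      by (intro ext) (simp add: Y_def card_all_edges k)
    then show "distr (measure_pmf (Pi_pmf (?E m) False (\<lambda>_. bernoulli_pmf p))) borel
      (\<lambda>b. (real (card {e \<in> ?E m. b e}) - card (?E m) * p) / sqrt (card (?E m) * (p * (1 - p)))) =
      distr (measure_pmf (?M m)) borel (Y m)"
      unfolding random_hypergraph_def map_pmf_rep_eq by (subst distr_distr) (auto simp: comp_def)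
  qed
  finally have Y: "weak_conv_m (\<lambda>m. distr (measure_pmf (?M m)) borel (Y m)) std_normal_distribution" .
  have L2: "(\<lambda>m. measure_pmf.expectation (?M m) (\<lambda>H. (Z m H - Y m H)\<^sup>2)) \<longlonglongrightarrow> 0"
  proof (rule tendsto_sandwich[of "\<lambda>_. 0"])
    let ?c = "2 * (1 / p - 1) * (overlap_const d)\<^sup>2"
    \<comment> \<open>The threshold beyond which the closeness estimate applies.\<close>
    define m0 where "m0 = nat \<lceil>(1 / p - 1) * overlap_const d\<rceil>"
    show "\<forall>\<^sub>F m in sequentially. measure_pmf.expectation (?M m) (\<lambda>H. (Z m H - Y m H)\<^sup>2) \<le> ?c / real m"
    proof (rule eventually_sequentiallyI[of "max 2 m0"])
      fix m assume m: "max 2 m0 \<le> m"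
      then have "(1 / p - 1) * overlap_const d \<le> m"
        unfolding m0_def by linarith
      with m assms d show "measure_pmf.expectation (?M m) (\<lambda>H. (Z m H - Y m H)\<^sup>2) \<le> ?c / real m"
        unfolding Z_def Y_def k by (intro standardized_num_loose_Hamilton_close) auto
    qed
    show "(\<lambda>m. ?c / real m) \<longlonglongrightarrow> 0"
      by (rule lim_const_over_n)
  qed (auto intro: always_eventually)
  have "weak_conv_m (\<lambda>m. distr (measure_pmf (?M m)) borel (Z m)) std_normal_distribution"
    by (rule weak_conv_m_L2_close[OF finite_set_random_hypergraph Y real_dist_normal_dist L2])
  then show ?thesis unfolding Z_def k(2) Let_def by (simp add: k(2))
qed

end
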